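(* Let $\Delta$ be a finite graph and $\Omega$ a $\gamma$-fold biased expansion of $\Delta$. If $\gamma=2$ then $\Omega=\langle\{\pm1\}\Delta\rangle$, and if $\gamma=3$ then $\Omega=\langle\mathbb Z_3\Delta\rangle$ (as biased expansions of $\Delta$, up to isomorphism).
   Context: A biased graph is a graph with a set of circles, called balanced, such that no theta subgraph contains exactly two balanced circles. A biased expansion of $\Delta$ is a biased graph $\Omega$ with surjective $p:\|\Omega\|\to\Delta$, identity on nodes, no balanced digon in any fiber, and the circle lifting property (for every circle $e_1\cdots e_l$ of $\Delta$ and any $\tilde e_i\in p^{-1}(e_i)$, $i<l$, exactly one $\tilde e_l\in p^{-1}(e_l)$ makes $\tilde e_1\cdots\tilde e_l$ balanced); it is $\gamma$-fold if every fiber $p^{-1}(e)$ has exactly $\gamma$ elements. For a group $G$, $\langle G\Delta\rangle$ is the biased expansion with an edge $ge$ for each $g\in G$, $e\in E(\Delta)$, of gain $g$ along a fixed orientation of $e$ ($g^{-1}$ reversed), projection $ge\mapsto e$, in which a circle is balanced iff the product of its gains read around it is the identity. $\{\pm1\}$ is the group of order two. *)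

theory Defs
  imports "HOL-Algebra.Elementary_Groups" "HOL-Algebra.Sym_Groups"
begin

section \<open>Graphs\<close>

text \<open>
  Undirected graphs; loops and parallel edges are allowed. The value \<open>ends G e\<close> is the set of end
  nodes of \<open>e\<close>; it is a singleton when \<open>e\<close> is a loop.
\<close>

record ('v, 'e) graph =
  nodes :: "'v set"
  edges :: "'e set"
  ends :: "'e \<Rightarrow> 'v set"

definition is_graph :: "('v, 'e, 'x) graph_scheme \<Rightarrow> bool" where
  "is_graph G \<longleftrightarrow>
    (\<forall>e\<in>edges G. ends G e \<subseteq> nodes G \<and> (card (ends G e) = 1 \<or> card (ends G e) = 2))"

definition finite_graph :: "('v, 'e, 'x) graph_scheme \<Rightarrow> bool" where
  "finite_graph G \<longleftrightarrow> is_graph G \<and> finite (nodes G) \<and> finite (edges G)"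

definition is_path :: "('v, 'e, 'x) graph_scheme \<Rightarrow> 'v list \<Rightarrow> 'e list \<Rightarrow> bool" where
  "is_path G vs es \<longleftrightarrow>
    length vs = Suc (length es) \<and> distinct vs \<and> set vs \<subseteq> nodes G \<and> set es \<subseteq> edges G \<and>
    (\<forall>i<length es. ends G (es ! i) = {vs ! i, vs ! Suc i})"

text \<open>
  A simple closed walk of length at least 1, whose edge \<open>es ! i\<close> runs from \<open>vs ! i\<close> to the
  cyclically next node. Length 1 gives loops and length 2 gives digons; distinctness of \<open>es\<close>
  matters only in the latter case.
\<close>

definition circle_walk :: "('v, 'e, 'x) graph_scheme \<Rightarrow> 'v list \<Rightarrow> 'e list \<Rightarrow> bool" where
  "circle_walk G vs es \<longleftrightarrow>
    es \<noteq> [] \<and> length vs = length es \<and> distinct vs \<and> distinct es \<and>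
    set vs \<subseteq> nodes G \<and> set es \<subseteq> edges G \<and>
    (\<forall>i<length es. ends G (es ! i) = {vs ! i, vs ! (Suc i mod length es)})"

text \<open>Circles and theta subgraphs are identified with their edge sets.\<close>

definition is_circle :: "('v, 'e, 'x) graph_scheme \<Rightarrow> 'e set \<Rightarrow> bool" where
  "is_circle G C \<longleftrightarrow> (\<exists>vs es. circle_walk G vs es \<and> C = set es)"

definition is_theta :: "('v, 'e, 'x) graph_scheme \<Rightarrow> 'e set \<Rightarrow> bool" where
  "is_theta G T \<longleftrightarrow>
    (\<exists>u w vs1 es1 vs2 es2 vs3 es3.
      u \<noteq> w \<and>
      is_path G vs1 es1 \<and> hd vs1 = u \<and> last vs1 = w \<and>
      is_path G vs2 es2 \<and> hd vs2 = u \<and> last vs2 = w \<and>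
      is_path G vs3 es3 \<and> hd vs3 = u \<and> last vs3 = w \<and>
      set vs1 \<inter> set vs2 = {u, w} \<and> set vs1 \<inter> set vs3 = {u, w} \<and> set vs2 \<inter> set vs3 = {u, w} \<and>
      set es1 \<inter> set es2 = {} \<and> set es1 \<inter> set es3 = {} \<and> set es2 \<inter> set es3 = {} \<and>
      T = set es1 \<union> set es2 \<union> set es3)"


section \<open>Biased graphs and biased expansions\<close>

record ('v, 'e) biased_graph = "('v, 'e) graph" +
  balanced :: "'e set set"

definition is_biased_graph :: "('v, 'e, 'x) biased_graph_scheme \<Rightarrow> bool" where
  "is_biased_graph \<Omega> \<longleftrightarrow>
    is_graph \<Omega> \<and> (\<forall>C\<in>balanced \<Omega>. is_circle \<Omega> C) \<and>
    (\<forall>T. is_theta \<Omega> T \<longrightarrow> card {C \<in> balanced \<Omega>. C \<subseteq> T} \<noteq> 2)"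

definition fiber :: "('v, 'f, 'x) graph_scheme \<Rightarrow> ('f \<Rightarrow> 'e) \<Rightarrow> 'e \<Rightarrow> 'f set" where
  "fiber \<Omega> p e = {e' \<in> edges \<Omega>. p e' = e}"

text \<open>
  In the circle lifting property \<open>es\<close> lists the edges \<open>e\<^sub>1 \<dots> e\<^sub>l\<close> of a circle of \<open>\<Delta>\<close>, and \<open>fs\<close> is
  an arbitrary choice of lifts of \<open>e\<^sub>1 \<dots> e\<^bsub>l-1\<^esub>\<close>.
\<close>

definition biased_expansion ::
  "('v, 'e, 'x) graph_scheme \<Rightarrow> ('v, 'f, 'y) biased_graph_scheme \<Rightarrow> ('f \<Rightarrow> 'e) \<Rightarrow> bool" where
  "biased_expansion \<Delta> \<Omega> p \<longleftrightarrow>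
    is_graph \<Delta> \<and> is_biased_graph \<Omega> \<and>
    nodes \<Omega> = nodes \<Delta> \<and> p ` edges \<Omega> = edges \<Delta> \<and> (\<forall>f\<in>edges \<Omega>. ends \<Omega> f = ends \<Delta> (p f)) \<and>
    (\<forall>e\<in>edges \<Delta>. \<forall>f\<in>fiber \<Omega> p e. \<forall>f'\<in>fiber \<Omega> p e. f \<noteq> f' \<longrightarrow> {f, f'} \<notin> balanced \<Omega>) \<and>
    (\<forall>vs es fs. circle_walk \<Delta> vs es \<and> list_all2 (\<lambda>f e. f \<in> fiber \<Omega> p e) fs (butlast es) \<longrightarrow>
      (\<exists>!f. f \<in> fiber \<Omega> p (last es) \<and> set (fs @ [f]) \<in> balanced \<Omega>))"

definition fold_biased_expansion ::
  "nat \<Rightarrow> ('v, 'e, 'x) graph_scheme \<Rightarrow> ('v, 'f, 'y) biased_graph_scheme \<Rightarrow> ('f \<Rightarrow> 'e) \<Rightarrow> bool" where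
  "fold_biased_expansion \<gamma> \<Delta> \<Omega> p \<longleftrightarrow>
    biased_expansion \<Delta> \<Omega> p \<and>
    (\<forall>e\<in>edges \<Delta>. finite (fiber \<Omega> p e) \<and> card (fiber \<Omega> p e) = \<gamma>)"

text \<open>Isomorphism over \<open>\<Delta>\<close>: the identity on nodes and compatible with the projections.\<close>

definition expansion_isomorphic ::
  "('v, 'f, 'x) biased_graph_scheme \<Rightarrow> ('f \<Rightarrow> 'e) \<Rightarrow>
   ('v, 'h, 'y) biased_graph_scheme \<Rightarrow> ('h \<Rightarrow> 'e) \<Rightarrow> bool" where
  "expansion_isomorphic \<Omega> p \<Omega>' p' \<longleftrightarrow>
    nodes \<Omega> = nodes \<Omega>' \<and>
    (\<exists>\<phi>. bij_betw \<phi> (edges \<Omega>) (edges \<Omega>') \<and>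
      (\<forall>f\<in>edges \<Omega>. ends \<Omega>' (\<phi> f) = ends \<Omega> f \<and> p' (\<phi> f) = p f) \<and>
      (\<forall>C. C \<subseteq> edges \<Omega> \<longrightarrow> (C \<in> balanced \<Omega> \<longleftrightarrow> \<phi> ` C \<in> balanced \<Omega>')))"


section \<open>Group expansions\<close>

text \<open>
  An orientation is given by choosing a tail of every edge. For a loop this leaves the sense of
  traversal undetermined, which is harmless: a circle containing a loop is that loop alone, and
  \<open>g\<close> is the identity iff its inverse is.
\<close>

definition orientation :: "('v, 'e, 'x) graph_scheme \<Rightarrow> ('e \<Rightarrow> 'v) \<Rightarrow> bool" where
  "orientation \<Delta> tail \<longleftrightarrow> (\<forall>e\<in>edges \<Delta>. tail e \<in> ends \<Delta> e)"

text \<open>The gain of the edge \<open>(g, e)\<close> when it is traversed starting at the node \<open>v\<close>.\<close>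

definition gain :: "('g, 'm) monoid_scheme \<Rightarrow> ('e \<Rightarrow> 'v) \<Rightarrow> 'v \<Rightarrow> 'g \<times> 'e \<Rightarrow> 'g" where
  "gain G tail v = (\<lambda>(g, e). if tail e = v then g else inv\<^bsub>G\<^esub> g)"

definition gain_product ::
  "('g, 'm) monoid_scheme \<Rightarrow> ('e \<Rightarrow> 'v) \<Rightarrow> 'v list \<Rightarrow> ('g \<times> 'e) list \<Rightarrow> 'g" where
  "gain_product G tail vs fs = foldr (\<otimes>\<^bsub>G\<^esub>) (map2 (gain G tail) vs fs) \<one>\<^bsub>G\<^esub>"

definition expanded_graph ::
  "('g, 'm) monoid_scheme \<Rightarrow> ('v, 'e, 'x) graph_scheme \<Rightarrow> ('v, 'g \<times> 'e) graph" where
  "expanded_graph G \<Delta> =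
    \<lparr>nodes = nodes \<Delta>, edges = carrier G \<times> edges \<Delta>, ends = (\<lambda>(g, e). ends \<Delta> e)\<rparr>"

text \<open>
  The group expansion \<open>\<langle>G\<Delta>\<rangle>\<close>, whose projection is \<^term>\<open>snd\<close>. Changing the initial node or the
  direction of the walk conjugates or inverts the gain product, so one walk around a circle
  suffices to decide balance.
\<close>

definition group_expansion ::
  "('g, 'm) monoid_scheme \<Rightarrow> ('v, 'e, 'x) graph_scheme \<Rightarrow> ('e \<Rightarrow> 'v) \<Rightarrow> ('v, 'g \<times> 'e) biased_graph" where
  "group_expansion G \<Delta> tail =
    \<lparr>nodes = nodes \<Delta>, edges = carrier G \<times> edges \<Delta>, ends = (\<lambda>(g, e). ends \<Delta> e),
     balanced = {set fs | vs fs. circle_walk (expanded_graph G \<Delta>) vs fs \<and>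
                                 gain_product G tail vs fs = \<one>\<^bsub>G\<^esub>}\<rparr>"

end

theory Submission
  imports Defs
begin

text \<open>
  A family of circles closed under theta graphs that contains all circles of an edge set \<open>A\<close> and one
  circle through a further edge \<open>e\<close> contains all circles of \<open>A \<union> {e}\<close>, since any two paths of \<open>A\<close> with
  the same ends are connected by reroutings inside theta graphs. Adding the edges of \<open>\<Delta>\<close> one by one,
  this yields a lift \<open>s\<close> of all edges such that all lifted circles are balanced; its edges get
  gain 1. If \<open>\<gamma> = 2\<close>, exchanging one edge of a lifted circle switches balance, so balance is the parity
  of the number of edges off \<open>s\<close>. If \<open>\<gamma> = 3\<close>, label every fiber by \<open>{-1, 0, 1}\<close> with \<open>s\<close> labelled 0; each
  labelling is determined up to sign. The balanced lifts of a circle form a Latin hypercube of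
  order 3, which is the solution set of a linear equation over \<open>\<int>\<^sub>3\<close> with coefficients \<open>\<plusminus>1\<close> that are
  determined by the lifts leaving \<open>s\<close> in only two edges. The signs are made consistent edge by edge:
  two consecutive edges of a path agree automatically if another path bypasses their common node, and
  otherwise all labels on one side of this cut node may be negated.
\<close>

section \<open>Paths and circles\<close>

text \<open>A labelling of the fibers is \<open>good\<close> on a circle if the balanced lifts of
  the circle are exactly the solutions of its linear equation. This property is closed under theta
  graphs just as balance is, so each newly added edge needs attention on a single circle only. The
  obstacle lies on that circle: it prescribes the signs of all labels along it relative to the new
  edge, while these labels are already tied to each other by the circles of the earlier edges. The
  two constraints never collide. If a bypass exists at a node of the circle, a theta graph forces
  the neighbouring edges to agree; if none exists, no earlier circle passes from one side of the
  node to the other, and one side may be negated.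

  Fold three enters through the fact that the only bijections of \<open>{-1, 0, 1}\<close> fixing 0
  are the identity and negation, both automorphisms of the additive group modulo 3. All equations
  are kept over the integers and read modulo 3; the passage to the group is made once, at the
  end.\<close>

lemma is_path_single [simp]: "is_path G [v] [] \<longleftrightarrow> v \<in> nodes G"
  by (auto simp: is_path_def)

lemma is_path_Cons:
  "is_path G (v # w # vs) (e # es) \<longleftrightarrow>
     v \<in> nodes G \<and> e \<in> edges G \<and> ends G e = {v, w} \<and> v \<notin> set (w # vs) \<and> is_path G (w # vs) es"
  by (auto simp: is_path_def All_less_Suc2)

lemma is_path_length: "is_path G vs es \<Longrightarrow> length vs = Suc (length es)"
  by (simp add: is_path_def)

lemma is_path_cases:
  assumes "is_path G vs es"
  obtains (single) v where "vs = [v]" "es = []" "v \<in> nodes G"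
  | (step) v w vs' e es' where "vs = v # w # vs'" "es = e # es'" "is_path G (w # vs') es'"
      "v \<in> nodes G" "e \<in> edges G" "ends G e = {v, w}" "v \<notin> set (w # vs')"
proof (cases es)
  case Nil
  with assms show ?thesis
    by (cases vs) (auto simp: is_path_def intro: single)
next
  case (Cons e es')
  with assms obtain v w vs' where "vs = v # w # vs'"
    by (auto simp: is_path_def length_Suc_conv)
  with Cons assms show ?thesis
    by (intro step[of v w vs' e es']) (simp_all add: is_path_Cons)
qed

lemma is_path_append:
  assumes "length vs = length es"
  shows "is_path G (vs @ x # ws) (es @ fs) \<longleftrightarrow>
    is_path G (vs @ [x]) es \<and> is_path G (x # ws) fs \<and> set vs \<inter> set ws = {}"
  using assms
proof (induction vs es rule: list_induct2)
  case Nil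
  then show ?case
    by (auto simp: is_path_def)
next
  case (Cons v vs e es)
  show ?case
  proof (cases vs)
    case Nil
    with Cons show ?thesis
      by (cases ws) (auto simp: is_path_Cons)
  next
    case (Cons w vs')
    with Cons.IH Cons.hyps show ?thesis
      by (auto simp: is_path_Cons)
  qed
qed

lemma is_path_appendD:
  assumes "is_path G (vs @ x # ws) (es @ fs)" "length es = length vs"
  shows "is_path G (vs @ [x]) es" "is_path G (x # ws) fs"
  using is_path_append[of vs es G x ws fs] assms by simp_all

lemma is_path_rev: "is_path G vs es \<Longrightarrow> is_path G (rev vs) (rev es)"
proof (induction es arbitrary: vs)
  case Nil
  then show ?case
    by (cases rule: is_path_cases) auto
next
  case (Cons e es)
  from Cons.prems obtain v w vs' where vs: "vs = v # w # vs'"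
    and *: "is_path G (w # vs') es" "v \<in> nodes G" "e \<in> edges G" "ends G e = {v, w}"
      "v \<notin> set (w # vs')"
    by (cases rule: is_path_cases) auto
  have "is_path G (rev vs' @ [w]) (rev es)"
    using Cons.IH[OF *(1)] by simp
  moreover have "w \<in> nodes G"
    using *(1) by (auto simp: is_path_def)
  ultimately have "is_path G (rev vs' @ w # [v]) (rev es @ [e])"
    using * is_path_length[OF *(1)] by (subst is_path_append) (auto simp: is_path_Cons insert_commute)
  then show ?case
    by (simp add: vs)
qed

lemma is_path_ends: "is_path G vs es \<Longrightarrow> f \<in> set es \<Longrightarrow> ends G f \<subseteq> set vs"
proof -
  assume p: "is_path G vs es" and "f \<in> set es"
  then obtain i where "i < length es" "f = es ! i"
    by (auto simp: in_set_conv_nth)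
  with p show "ends G f \<subseteq> set vs"
    by (simp add: is_path_def)
qed

lemma is_path_distinct_edges: "is_path G vs es \<Longrightarrow> distinct es"
proof (induction es arbitrary: vs)
  case (Cons e es)
  from Cons.prems show ?case
  proof (cases rule: is_path_cases)
    case (step v w vs')
    then show ?thesis
      using Cons.IH is_path_ends[of G "w # vs'" es e] by auto
  qed simp
qed simp

text \<open>Only the first edge of a path meets its first node, so the start and the edge set
  determine the path edge by edge. Hence two walks round one circle differ only by rotation and
  reversal, which makes signed sums well defined up to sign.\<close>

lemma is_path_unique:
  assumes "is_path G vs es" "is_path G vs' es'" "hd vs = hd vs'" "set es = set es'"
  shows "vs = vs' \<and> es = es'"
  using assms
proof (induction es arbitrary: vs vs' es')
  case Nil
  then show ?case
    by (auto elim!: is_path_cases)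
next
  case (Cons e es)
  from Cons.prems(1) obtain v w ws where vs: "vs = v # w # ws" "is_path G (w # ws) es"
    "ends G e = {v, w}" "v \<notin> set (w # ws)"
    by (cases rule: is_path_cases) auto
  have "es' \<noteq> []"
    using Cons.prems(4) by auto
  with Cons.prems(2,3) obtain w' ws' e' fs where vs': "vs' = v # w' # ws'" "es' = e' # fs"
    "is_path G (w' # ws') fs" "ends G e' = {v, w'}" "v \<notin> set (w' # ws')"
    by (cases rule: is_path_cases) (auto simp: vs(1))
  have "v \<notin> ends G f" if "f \<in> set es" for f
    using is_path_ends[OF vs(2) that] vs(4) by auto
  moreover have "e' \<in> insert e (set es)" "v \<in> ends G e'"
    using Cons.prems(4) vs' by auto
  ultimately have e: "e = e'"
    by auto
  then have "w = w'"
    using vs vs' by (auto simp: doubleton_eq_iff)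
  moreover have "set es = set fs"
    using is_path_distinct_edges[OF Cons.prems(1)] is_path_distinct_edges[OF Cons.prems(2)]
      Cons.prems(4) e vs'(2) by auto
  ultimately show ?case
    using Cons.IH[OF vs(2) vs'(3)] vs vs' e by auto
qed

text \<open>Either the new node prolongs the path, or it was visited before and the path is cut back
  to it. Thus reachability by paths passes along an edge.\<close>

lemma is_path_extend:
  assumes "is_path G vs es" "g \<in> edges G" "ends G g = {last vs, x}" "x \<in> nodes G"
  obtains vs' es' where "is_path G vs' es'" "hd vs' = hd vs" "last vs' = x"
    "set vs' \<subseteq> insert x (set vs)" "set es' \<subseteq> insert g (set es)"
proof (cases "x \<in> set vs")
  case True
  then obtain as bs where vs: "vs = as @ x # bs"
    by (auto simp: in_set_conv_decomp)
  define es1 es2 where "es1 = take (length as) es" "es2 = drop (length as) es"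
  have es: "es = es1 @ es2" "length as = length es1"
    using is_path_length[OF assms(1)] by (auto simp: es1_es2_def vs)
  have "is_path G (as @ [x]) es1"
    using assms(1) unfolding vs es(1) by (subst (asm) is_path_append) (use es in auto)
  then show ?thesis
    by (rule that) (auto simp: vs es hd_append)
next
  case False
  obtain as y where vs: "vs = as @ [y]"
    using is_path_length[OF assms(1)] by (cases vs rule: rev_cases) auto
  have "y \<in> nodes G"
    using assms(1) by (auto simp: is_path_def vs)
  then have "is_path G (as @ y # [x]) (es @ [g])"
    using assms is_path_length[OF assms(1)] False unfolding vs
    by (subst is_path_append) (auto simp: is_path_Cons)
  then show ?thesis
    by (rule that) (auto simp: vs hd_append)
qed

text \<open>A circle is a path closed by one further edge; the arguments below put the edge of
  interest in this last position. Empty \<open>es\<close> gives a loop, since then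
  \<open>hd vs\<close> and \<open>last vs\<close> coincide.\<close>

lemma circle_walk_snoc:
  "circle_walk G vs (es @ [e]) \<longleftrightarrow>
     is_path G vs es \<and> e \<in> edges G \<and> e \<notin> set es \<and> ends G e = {last vs, hd vs}"
proof
  assume c: "circle_walk G vs (es @ [e])"
  then have len: "length vs = Suc (length es)" and "vs \<noteq> []"
    and nth: "\<forall>i<Suc (length es). ends G ((es @ [e]) ! i) = {vs ! i, vs ! (Suc i mod Suc (length es))}"
    by (auto simp: circle_walk_def)
  have "ends G (es ! i) = {vs ! i, vs ! Suc i}" if "i < length es" for i
    using nth[rule_format, of i] that by (simp add: nth_append)
  moreover have "ends G e = {last vs, hd vs}"
    using nth[rule_format, of "length es"] len \<open>vs \<noteq> []\<close> by (simp add: last_conv_nth hd_conv_nth)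
  ultimately show "is_path G vs es \<and> e \<in> edges G \<and> e \<notin> set es \<and> ends G e = {last vs, hd vs}"
    using c len by (auto simp: circle_walk_def is_path_def)
next
  assume a: "is_path G vs es \<and> e \<in> edges G \<and> e \<notin> set es \<and> ends G e = {last vs, hd vs}"
  then have len: "length vs = Suc (length es)" and "vs \<noteq> []"
    by (auto simp: is_path_def)
  have "ends G ((es @ [e]) ! i) = {vs ! i, vs ! (Suc i mod Suc (length es))}"
    if "i < Suc (length es)" for i
  proof (cases "i = length es")
    case True
    then show ?thesis
      using a len \<open>vs \<noteq> []\<close> by (simp add: last_conv_nth hd_conv_nth)
  next
    case False
    then show ?thesis
      using a that by (simp add: is_path_def nth_append)
  qed
  then show "circle_walk G vs (es @ [e])"
    using a is_path_distinct_edges[of G vs es] by (auto simp: circle_walk_def is_path_def)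
qed

lemma circle_walk_rotate:
  assumes "circle_walk G vs es"
  shows "circle_walk G (rotate n vs) (rotate n es)"
proof -
  have len: "length vs = length es" and "es \<noteq> []"
    and nth: "\<And>i. i < length es \<Longrightarrow> ends G (es ! i) = {vs ! i, vs ! (Suc i mod length es)}"
    using assms by (auto simp: circle_walk_def)
  have "ends G (rotate n es ! i) = {rotate n vs ! i, rotate n vs ! (Suc i mod length es)}"
    if "i < length es" for i
  proof -
    have "rotate n vs ! (Suc i mod length es) = vs ! (Suc ((n + i) mod length es) mod length es)"
      using len \<open>es \<noteq> []\<close> by (simp add: nth_rotate mod_Suc_eq mod_add_right_eq)
    moreover have "rotate n vs ! i = vs ! ((n + i) mod length es)"
      and "rotate n es ! i = es ! ((n + i) mod length es)"
      using len that by (simp_all add: nth_rotate)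
    moreover have "(n + i) mod length es < length es"
      using \<open>es \<noteq> []\<close> by simp
    ultimately show ?thesis
      using nth[of "(n + i) mod length es"] by simp
  qed
  then show ?thesis
    using assms by (auto simp: circle_walk_def)
qed

lemma rotate_to_hd:
  assumes "x \<in> set xs"
  obtains n where "hd (rotate n xs) = x"
  using assms by (metis hd_conv_nth in_set_conv_nth list.size(3) not_less_zero
    nth_rotate add_0_right length_greater_0_conv length_rotate mod_less)

lemma rotate_to_last:
  assumes "x \<in> set xs"
  obtains n where "last (rotate n xs) = x"
proof -
  obtain as bs where xs: "xs = as @ x # bs"
    using assms by (auto simp: in_set_conv_decomp)
  have "rotate (length (as @ [x])) ((as @ [x]) @ bs) = bs @ as @ [x]"
    by (subst rotate_append) simp
  then have "last (rotate (length (as @ [x])) xs) = x"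
    unfolding xs by (metis append.assoc append_Cons append_Nil last_snoc)
  then show ?thesis
    by (rule that)
qed

lemma circle_walk_through:
  assumes "circle_walk G vs es" "e \<in> set es"
  obtains n es' where "rotate n es = es' @ [e]" "circle_walk G (rotate n vs) (es' @ [e])"
proof -
  obtain n where "last (rotate n es) = e"
    using rotate_to_last[OF assms(2)] by blast
  then have "rotate n es = butlast (rotate n es) @ [e]"
    using assms(2) by (metis append_butlast_last_id empty_iff empty_set rotate_is_Nil_conv)
  then show ?thesis
    using circle_walk_rotate[OF assms(1), of n] that by metis
qed

lemma is_circle_through:
  assumes "is_circle G C" "e \<in> C"
  obtains vs es where "circle_walk G vs (es @ [e])" "C = insert e (set es)"
proof -
  obtain vs es where w: "circle_walk G vs es" "C = set es"
    using assms(1) by (auto simp: is_circle_def)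
  obtain n es' where n: "rotate n es = es' @ [e]" "circle_walk G (rotate n vs) (es' @ [e])"
    using circle_walk_through[OF w(1)] w(2) assms(2) by blast
  have "set es = insert e (set es')"
    using arg_cong[OF n(1), of set] by simp
  then show ?thesis
    using that n w by auto
qed

lemma is_circle_edges: "is_circle G C \<Longrightarrow> C \<subseteq> edges G"
  by (auto simp: is_circle_def circle_walk_def)

lemma is_circle_finite: "is_circle G C \<Longrightarrow> finite C"
  by (auto simp: is_circle_def)

lemma is_circle_nonempty: "is_circle G C \<Longrightarrow> C \<noteq> {}"
  by (auto simp: is_circle_def circle_walk_def)

section \<open>Theta graphs\<close>

text \<open>Edge disjointness is asked separately because two copies of the same one-edge path
  satisfy all the conditions on nodes.\<close>

definition internally_disjoint ::
  "('v, 'e, 'x) graph_scheme \<Rightarrow> 'v list \<Rightarrow> 'e list \<Rightarrow> 'v list \<Rightarrow> 'e list \<Rightarrow> bool" where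
  "internally_disjoint G vs es vs' es' \<longleftrightarrow>
    is_path G vs es \<and> is_path G vs' es' \<and> hd vs = hd vs' \<and> last vs = last vs' \<and> hd vs \<noteq> last vs \<and>
    set vs \<inter> set vs' = {hd vs, last vs} \<and> set es \<inter> set es' = {}"

definition theta_paths ::
  "('v, 'e, 'x) graph_scheme \<Rightarrow> 'v list \<Rightarrow> 'e list \<Rightarrow> 'v list \<Rightarrow> 'e list \<Rightarrow> 'v list \<Rightarrow> 'e list \<Rightarrow> bool"
  where
  "theta_paths G vs1 es1 vs2 es2 vs3 es3 \<longleftrightarrow>
    internally_disjoint G vs1 es1 vs2 es2 \<and> internally_disjoint G vs1 es1 vs3 es3 \<and>
    internally_disjoint G vs2 es2 vs3 es3"

lemma internally_disjoint_sym:
  "internally_disjoint G vs es vs' es' \<Longrightarrow> internally_disjoint G vs' es' vs es"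
  by (auto simp: internally_disjoint_def)

lemma internally_disjoint_nonempty:
  assumes "internally_disjoint G vs es vs' es'"
  shows "es \<noteq> []" "es' \<noteq> []"
proof -
  have "es \<noteq> []" if "is_path G vs es" "hd vs \<noteq> last vs" for vs es
    using that by (cases rule: is_path_cases) auto
  from this[of vs es] this[of vs' es'] show "es \<noteq> []" "es' \<noteq> []"
    using assms[unfolded internally_disjoint_def] by metis+
qed

lemma theta_paths_is_theta:
  "theta_paths G vs1 es1 vs2 es2 vs3 es3 \<Longrightarrow> is_theta G (set es1 \<union> set es2 \<union> set es3)"
  unfolding is_theta_def theta_paths_def internally_disjoint_def by metis

text \<open>The walk follows the first path and returns along the second; \<open>butlast\<close> and
  \<open>tl\<close> remove the doubled end nodes. It is given explicitly because signed sums refer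
  to a walk and not only to its edge set.\<close>

lemma internally_disjoint_circle_walk:
  assumes "internally_disjoint G vs es vs' es'"
  shows "circle_walk G (butlast vs @ rev (tl vs')) (es @ rev es')"
proof -
  note d = assms[unfolded internally_disjoint_def]
  obtain v w ws e fs where 1: "vs' = v # w # ws" "es' = e # fs" "is_path G (w # ws) fs"
    "v \<in> nodes G" "e \<in> edges G" "ends G e = {v, w}" "v \<notin> set (w # ws)"
    using d by (cases es') (auto elim: is_path_cases)
  obtain as x where 2: "vs = as @ [x]"
    using d by (cases vs rule: rev_cases) (auto simp: is_path_def)
  obtain bs where 3: "w # ws = bs @ [x]"
    using d 1 2 by (metis last.simps last_snoc list.discI append_butlast_last_id)
  have v: "v = hd (as @ [x])" "v \<noteq> x" "as \<noteq> []"
    using d 1 2 by auto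
  have "is_path G (x # rev bs) (rev fs)"
    using is_path_rev[OF 1(3)] unfolding 3 by simp
  moreover have "set as \<inter> set bs = {}"
  proof -
    have "set as \<inter> set bs \<subseteq> {v, x}"
    proof -
      have "set as \<inter> set bs \<subseteq> set vs \<inter> set vs'"
        unfolding 1 2 3 by auto
      also have "\<dots> = {hd vs, last vs}"
        using d by blast
      also have "\<dots> = {v, x}"
        unfolding 2 using v(1) by simp
      finally show ?thesis .
    qed
    moreover have "x \<notin> set as" "v \<notin> set bs"
      using d 1 2 3 by (auto simp: is_path_def)
    ultimately show ?thesis
      by auto
  qed
  ultimately have p: "is_path G (as @ x # rev bs) (es @ rev fs)"
    using d is_path_length[of G vs es] 2 by (subst is_path_append) auto
  have "last (x # rev bs) = w"
    using 3 by (metis last_rev list.sel(1) rev.simps(2) rev_append rev_rev_ident append.left_neutral append_Cons rev_is_Nil_conv list.discI)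
  then have "circle_walk G (as @ x # rev bs) ((es @ rev fs) @ [e])"
    using p d 1 v is_path_distinct_edges[of G vs' es']
    by (subst circle_walk_snoc) (auto simp: insert_commute hd_append)
  then show ?thesis
    by (simp add: 1 2 3)
qed

lemma internally_disjoint_is_circle:
  assumes "internally_disjoint G vs es vs' es'"
  shows "is_circle G (set es \<union> set es')"
  using internally_disjoint_circle_walk[OF assms] unfolding is_circle_def
  by (metis set_append set_rev)

text \<open>The nodes \<open>x\<close> and \<open>y\<close> cut the circle into the segment
  \<open>gs\<close> and a complementary arc, which passes through the closing edge \<open>e\<close>.
  That arc is reversed so that all three paths run from \<open>x\<close> to
  \<open>y\<close>.\<close>

lemma chord_theta:
  assumes c: "circle_walk G (ps @ x # as @ y # bs) ((es @ gs @ hs) @ [e])"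
    and len: "length es = length ps" "length gs = Suc (length as)"
    and r: "is_path G (x # as' @ [y]) gs'"
    and disj: "set as' \<inter> set (ps @ x # as @ y # bs) = {}" "set gs' \<inter> insert e (set (es @ gs @ hs)) = {}"
  shows "theta_paths G (x # as @ [y]) gs (rev (y # bs @ ps @ [x])) (rev (hs @ e # es)) (x # as' @ [y]) gs'"
proof -
  have p: "is_path G (ps @ x # as @ y # bs) (es @ gs @ hs)" and e: "e \<in> edges G" "e \<notin> set (es @ gs @ hs)"
    "ends G e = {last (y # bs), hd (ps @ [x])}"
    using c unfolding circle_walk_snoc by (auto simp: hd_append)
  have dv: "distinct (ps @ x # as @ y # bs)" and de: "distinct (es @ gs @ hs)"
    using p is_path_distinct_edges[OF p] by (auto simp: is_path_def)
  have p1: "is_path G (ps @ [x]) es" and p23: "is_path G (x # as @ y # bs) (gs @ hs)"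
    using p len(1) by (subst (asm) is_path_append; simp)+
  have "is_path G ((x # as) @ y # bs) (gs @ hs)"
    using p23 by simp
  then have p2: "is_path G (x # as @ [y]) gs" and p3: "is_path G (y # bs) hs"
    using len(2) by (subst (asm) is_path_append; simp)+
  have p3e: "is_path G ((y # bs) @ ps @ [x]) ((hs @ [e]) @ es)"
  proof -
    obtain q qs where q: "ps @ [x] = q # qs"
      by (cases "ps @ [x]") auto
    have dq: "set (y # bs) \<inter> set (q # qs) = {}"
      using dv unfolding q[symmetric] by auto
    obtain cs z where z: "y # bs = cs @ [z]"
      by (metis append_butlast_last_id list.discI)
    have "is_path G [z, q] [e]"
    proof -
      have "q \<in> nodes G" "z \<in> nodes G"
        using p1 p3 unfolding q z by (auto simp: is_path_def)
      moreover have "ends G e = {z, q}"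
        using e(3) unfolding q z by simp
      moreover have "z \<noteq> q"
        using dq z by auto
      ultimately show ?thesis
        using e(1) by (simp add: is_path_Cons)
    qed
    moreover have "q \<notin> set cs"
      using dq z by auto
    ultimately have "is_path G (cs @ z # [q]) (hs @ [e])"
      using p3 z is_path_length[OF p3] by (subst is_path_append) auto
    then have "is_path G ((cs @ [z]) @ q # qs) ((hs @ [e]) @ es)"
      using p1 q z dq is_path_length[OF p3] by (subst is_path_append) auto
    then show ?thesis
      unfolding q z by simp
  qed
  then have p4: "is_path G (rev (y # bs @ ps @ [x])) (rev (hs @ e # es))"
    using is_path_rev[OF p3e] by simp
  have "x \<noteq> y"
    using dv by auto
  have "internally_disjoint G (x # as @ [y]) gs (rev (y # bs @ ps @ [x])) (rev (hs @ e # es))"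
    unfolding internally_disjoint_def using p2 p4 \<open>x \<noteq> y\<close> dv de e(2) by auto
  moreover have "internally_disjoint G (x # as @ [y]) gs (x # as' @ [y]) gs'"
    unfolding internally_disjoint_def using p2 r \<open>x \<noteq> y\<close> disj by auto
  moreover have "internally_disjoint G (rev (y # bs @ ps @ [x])) (rev (hs @ e # es)) (x # as' @ [y]) gs'"
    unfolding internally_disjoint_def using p4 r \<open>x \<noteq> y\<close> disj by auto
  ultimately show ?thesis
    by (simp add: theta_paths_def)
qed

section \<open>The circles contained in a theta graph\<close>

lemma circle_walk_rev:
  assumes "circle_walk G vs (es @ [e])"
  shows "circle_walk G (rev vs) (rev es @ [e])"
  using assms is_path_rev[of G vs es]
  by (auto simp: circle_walk_snoc last_rev hd_rev insert_commute)

lemma is_path_card_ends: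
  assumes "is_path G vs es" "f \<in> set es"
  shows "card (ends G f) = 2"
proof -
  obtain i where "i < length es" "f = es ! i"
    using assms(2) by (auto simp: in_set_conv_nth)
  with assms(1) show ?thesis
    by (auto simp: is_path_def card_2_iff nth_eq_iff_index_eq intro!: exI[of _ "vs ! i"] exI[of _ "vs ! Suc i"])
qed

lemma is_path_hd_edge:
  assumes "is_path G vs es" "hd vs \<noteq> last vs"
  shows "es \<noteq> []" "hd vs \<in> ends G (hd es)" "\<And>f. f \<in> set es \<Longrightarrow> hd vs \<in> ends G f \<Longrightarrow> f = hd es"
proof -
  from assms obtain v w ws e fs where *: "vs = v # w # ws" "es = e # fs" "is_path G (w # ws) fs"
    "ends G e = {v, w}" "v \<notin> set (w # ws)"
    by (cases rule: is_path_cases) auto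
  show "es \<noteq> []" "hd vs \<in> ends G (hd es)"
    using * by auto
  show "f = hd es" if "f \<in> set es" "hd vs \<in> ends G f" for f
    using that * is_path_ends[OF *(3), of f] by auto
qed

lemma is_path_inner_node:
  assumes "is_path G vs (xs @ a # b # ys)"
  obtains y where "y \<in> set vs" "y \<noteq> hd vs" "y \<noteq> last vs" "y \<in> ends G a" "y \<in> ends G b"
    "\<And>f. f \<in> set (xs @ a # b # ys) \<Longrightarrow> y \<in> ends G f \<Longrightarrow> f = a \<or> f = b"
proof -
  let ?es = "xs @ a # b # ys" and ?k = "length xs"
  have len: "length vs = Suc (length ?es)" and d: "distinct vs"
    and ends: "\<And>i. i < length ?es \<Longrightarrow> ends G (?es ! i) = {vs ! i, vs ! Suc i}"
    using assms by (auto simp: is_path_def)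
  show ?thesis
  proof
    show "vs ! Suc ?k \<in> set vs"
      using len by simp
    have "vs \<noteq> []"
      using len by auto
    then have "hd vs = vs ! 0" "last vs = vs ! length ?es"
      using len by (simp_all add: hd_conv_nth last_conv_nth)
    then show "vs ! Suc ?k \<noteq> hd vs" "vs ! Suc ?k \<noteq> last vs"
      using d len by (simp_all add: nth_eq_iff_index_eq)
    show "vs ! Suc ?k \<in> ends G a" "vs ! Suc ?k \<in> ends G b"
      using ends[of ?k] ends[of "Suc ?k"] by (simp_all add: nth_append)
    fix f assume "f \<in> set ?es" "vs ! Suc ?k \<in> ends G f"
    then obtain i where i: "i < length ?es" "f = ?es ! i"
      by (metis in_set_conv_nth)
    then have "vs ! Suc ?k = vs ! i \<or> vs ! Suc ?k = vs ! Suc i"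
      using ends[of i] \<open>vs ! Suc ?k \<in> ends G f\<close> by auto
    then have "i = Suc ?k \<or> i = ?k"
      using d len i(1) by (auto simp: nth_eq_iff_index_eq)
    then show "f = a \<or> f = b"
      using i(2) by (auto simp: nth_append)
  qed
qed

lemma list_all_or_none:
  assumes "\<And>xs a b ys. es = xs @ a # b # ys \<Longrightarrow> P a \<longleftrightarrow> P b"
  shows "(\<forall>a\<in>set es. P a) \<or> (\<forall>a\<in>set es. \<not> P a)"
  using assms
proof (induction es)
  case (Cons e es)
  have "(\<forall>a\<in>set es. P a) \<or> (\<forall>a\<in>set es. \<not> P a)"
    using Cons.prems[of "e # _"] by (intro Cons.IH) auto
  moreover have "P e \<longleftrightarrow> P (hd es)" if "es \<noteq> []"
    using Cons.prems[of "[]" e "hd es" "tl es"] that by simp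
  ultimately show ?case
    by (cases es) auto
qed simp

text \<open>Rotating \<open>e\<close> into last position leaves a path between its ends, whose first
  edge is the neighbour of \<open>e\<close> at one end; reversal treats the other end. The
  cardinality condition excludes a loop, which has no neighbour.\<close>

lemma circle_degree:
  assumes "is_circle G C" "e \<in> C" "v \<in> ends G e" "card (ends G e) = 2"
  shows "\<exists>!e'. e' \<in> C \<and> e' \<noteq> e \<and> v \<in> ends G e'"
proof -
  obtain vs es where w: "circle_walk G vs (es @ [e])" and C: "C = insert e (set es)"
    using is_circle_through[OF assms(1,2)] by blast
  have "\<exists>!e'. e' \<in> C \<and> e' \<noteq> e \<and> v \<in> ends G e'"
    if w: "circle_walk G vs (es @ [e])" and C: "C = insert e (set es)" and v: "v = hd vs" for vs es
  proof -
    have p: "is_path G vs es" "e \<notin> set es" "ends G e = {last vs, hd vs}"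
      using w by (auto simp: circle_walk_snoc)
    then have "hd vs \<noteq> last vs"
      using assms(4) by auto
    from is_path_hd_edge[OF p(1) this] show ?thesis
      using p(2) unfolding C v by (intro ex1I[of _ "hd es"]) auto
  qed
  note * = this
  have "v = hd vs \<or> v = hd (rev vs)"
    using w assms(3) by (auto simp: circle_walk_snoc hd_rev)
  then show ?thesis
    using *[OF w C] *[OF circle_walk_rev[OF w]] C by (metis set_rev)
qed

lemma theta_paths_rotate:
  "theta_paths G vs1 es1 vs2 es2 vs3 es3 \<Longrightarrow> theta_paths G vs2 es2 vs3 es3 vs1 es1"
  by (auto simp: theta_paths_def intro: internally_disjoint_sym)

lemma theta_paths_swap:
  "theta_paths G vs1 es1 vs2 es2 vs3 es3 \<Longrightarrow> theta_paths G vs1 es1 vs3 es3 vs2 es2"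
  by (auto simp: theta_paths_def intro: internally_disjoint_sym)

text \<open>An inner node of the first path meets only the two consecutive edges of that path, so by
  degree a circle in the theta graph contains both of them or neither.\<close>

lemma theta_path_all_or_none:
  assumes t: "theta_paths G vs1 es1 vs2 es2 vs3 es3"
    and C: "is_circle G C" "C \<subseteq> set es1 \<union> set es2 \<union> set es3"
  shows "set es1 \<subseteq> C \<or> set es1 \<inter> C = {}"
proof -
  have d: "internally_disjoint G vs1 es1 vs2 es2" "internally_disjoint G vs1 es1 vs3 es3"
    using t by (auto simp: theta_paths_def)
  then have p: "is_path G vs1 es1" "is_path G vs2 es2" "is_path G vs3 es3"
    by (auto simp: internally_disjoint_def)
  have "(\<forall>a\<in>set es1. a \<in> C) \<or> (\<forall>a\<in>set es1. a \<notin> C)"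
  proof (rule list_all_or_none)
    fix xs a b ys assume es: "es1 = xs @ a # b # ys"
    then have "is_path G vs1 (xs @ a # b # ys)"
      using p(1) by simp
    then obtain y where y: "y \<in> set vs1" "y \<noteq> hd vs1" "y \<noteq> last vs1" "y \<in> ends G a" "y \<in> ends G b"
      "\<And>f. f \<in> set es1 \<Longrightarrow> y \<in> ends G f \<Longrightarrow> f = a \<or> f = b"
      by (rule is_path_inner_node) (auto simp: es)
    have "y \<notin> set vs2" "y \<notin> set vs3"
      using d y(1-3) by (auto simp: internally_disjoint_def)
    then have inc: "f = a \<or> f = b" if "f \<in> C" "y \<in> ends G f" for f
      using that C(2) y(6) is_path_ends[OF p(2)] is_path_ends[OF p(3)] by blast
    have "card (ends G a) = 2" "card (ends G b) = 2"
      using is_path_card_ends[OF p(1)] by (auto simp: es)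
    then show "a \<in> C \<longleftrightarrow> b \<in> C"
      using circle_degree[OF C(1), of a y] circle_degree[OF C(1), of b y] y(4,5) inc by metis
  qed
  then show ?thesis
    by auto
qed

text \<open>A circle that meets the first path contains all of it, in particular its first edge, and
  therefore exactly one further edge at the common start node. Only the first edges of the other two
  paths are available there, and the chosen one brings in its whole path.\<close>

lemma theta_circles_aux:
  assumes t: "theta_paths G vs1 es1 vs2 es2 vs3 es3"
    and C: "is_circle G C" "C \<subseteq> set es1 \<union> set es2 \<union> set es3" and ne: "C \<inter> set es1 \<noteq> {}"
  shows "C = set es1 \<union> set es2 \<or> C = set es1 \<union> set es3"
proof -
  have d: "internally_disjoint G vs1 es1 vs2 es2" "internally_disjoint G vs1 es1 vs3 es3"
    "internally_disjoint G vs2 es2 vs3 es3"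
    using t by (auto simp: theta_paths_def)
  note d' = d[unfolded internally_disjoint_def]
  have aon: "set es1 \<subseteq> C \<or> set es1 \<inter> C = {}" "set es2 \<subseteq> C \<or> set es2 \<inter> C = {}"
    "set es3 \<subseteq> C \<or> set es3 \<inter> C = {}"
    using theta_path_all_or_none[OF t C] theta_path_all_or_none[OF theta_paths_rotate[OF t] C(1)]
      theta_path_all_or_none[OF theta_paths_rotate[OF theta_paths_rotate[OF t]] C(1)] C(2) by blast+
  then have 1: "set es1 \<subseteq> C"
    using ne by blast
  define u where "u = hd vs1"
  have h1: "es1 \<noteq> []" "u \<in> ends G (hd es1)" "\<And>f. f \<in> set es1 \<Longrightarrow> u \<in> ends G f \<Longrightarrow> f = hd es1"
    using is_path_hd_edge[of G vs1 es1] d'(1) unfolding u_def by blast+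
  have "is_path G vs2 es2" "hd vs2 \<noteq> last vs2" "u = hd vs2"
    using d'(3) d'(1) unfolding u_def by blast+
  note h2 = is_path_hd_edge[OF this(1,2), folded this(3)]
  have "is_path G vs3 es3" "hd vs3 \<noteq> last vs3" "u = hd vs3"
    using d'(2,3) unfolding u_def by metis+
  note h3 = is_path_hd_edge[OF this(1,2), folded this(3)]
  have ne: "hd es1 \<noteq> hd es2" "hd es1 \<noteq> hd es3" "hd es2 \<noteq> hd es3"
    using d' hd_in_set[OF h1(1)] hd_in_set[OF h2(1)] hd_in_set[OF h3(1)] by (metis disjoint_iff)+
  have "card (ends G (hd es1)) = 2"
    using is_path_card_ends[of G vs1 es1] d'(1) h1(1) by auto
  moreover have "hd es1 \<in> C"
    using 1 hd_in_set[OF h1(1)] by blast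
  ultimately have "\<exists>!e'. e' \<in> C \<and> e' \<noteq> hd es1 \<and> u \<in> ends G e'"
    using circle_degree[OF C(1) _ h1(2)] by blast
  then obtain e' where e': "e' \<in> C" "e' \<noteq> hd es1" "u \<in> ends G e'"
    and uni: "\<And>f. f \<in> C \<Longrightarrow> f \<noteq> hd es1 \<Longrightarrow> u \<in> ends G f \<Longrightarrow> f = e'"
    by blast
  have "e' = hd es2 \<or> e' = hd es3"
    using e' C(2) h1(3) h2(3) h3(3) by blast
  then show ?thesis
  proof
    assume "e' = hd es2"
    then have "set es2 \<subseteq> C"
      using e'(1) aon(2) hd_in_set[OF h2(1)] by blast
    moreover have "hd es3 \<notin> C"
      using uni[of "hd es3"] ne h3(2) \<open>e' = hd es2\<close> by metis
    then have "set es3 \<inter> C = {}"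
      using aon(3) hd_in_set[OF h3(1)] by blast
    ultimately have "C = set es1 \<union> set es2"
      using 1 C(2) by blast
    then show ?thesis ..
  next
    assume "e' = hd es3"
    then have "set es3 \<subseteq> C"
      using e'(1) aon(3) hd_in_set[OF h3(1)] by blast
    moreover have "hd es2 \<notin> C"
      using uni[of "hd es2"] ne h2(2) \<open>e' = hd es3\<close> by metis
    then have "set es2 \<inter> C = {}"
      using aon(2) hd_in_set[OF h2(1)] by blast
    ultimately have "C = set es1 \<union> set es3"
      using 1 C(2) by blast
    then show ?thesis ..
  qed
qed

text \<open>The axiom of biased graphs counts all balanced sets inside a theta graph; it can be
  applied to three given circles only if there are no others.\<close>

lemma theta_circles:
  assumes t: "theta_paths G vs1 es1 vs2 es2 vs3 es3"
    and C: "is_circle G C" "C \<subseteq> set es1 \<union> set es2 \<union> set es3"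
  shows "C = set es1 \<union> set es2 \<or> C = set es1 \<union> set es3 \<or> C = set es2 \<union> set es3"
proof -
  have "C \<inter> set es1 \<noteq> {} \<or> C \<inter> set es2 \<noteq> {}"
  proof (rule ccontr)
    assume "\<not> ?thesis"
    then have "C \<subseteq> set es3"
      using C(2) by blast
    moreover have "C \<inter> set es3 \<noteq> {}"
      using is_circle_nonempty[OF C(1)] calculation by blast
    then have "C = set es3 \<union> set es1 \<or> C = set es3 \<union> set es2"
      using theta_circles_aux[OF theta_paths_rotate[OF theta_paths_rotate[OF t]] C(1)] C(2) by blast
    with \<open>C \<subseteq> set es3\<close> have "set es1 \<subseteq> set es3 \<or> set es2 \<subseteq> set es3"
      by blast
    moreover have d: "internally_disjoint G vs1 es1 vs3 es3" "internally_disjoint G vs2 es2 vs3 es3"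
      using t by (auto simp: theta_paths_def)
    then have "set es1 \<noteq> {}" "set es2 \<noteq> {}"
      using internally_disjoint_nonempty by fastforce+
    moreover have "set es1 \<inter> set es3 = {}" "set es2 \<inter> set es3 = {}"
      using d by (auto simp: internally_disjoint_def)
    ultimately show False
      by (metis inf.absorb1)
  qed
  then show ?thesis
    using theta_circles_aux[OF t C] theta_circles_aux[OF theta_paths_rotate[OF t] C(1)] C(2) by blast
qed

section \<open>Linear classes of circles\<close>

text \<open>Linear classes of circles are known from matroid theory: no theta graph has exactly two
  of its three circles in \<open>X\<close>. Naming one conclusion suffices because the three paths
  may be permuted.\<close>

definition linear_class :: "('v, 'e, 'x) graph_scheme \<Rightarrow> 'e set set \<Rightarrow> bool" where
  "linear_class G X \<longleftrightarrow>
    (\<forall>vs1 es1 vs2 es2 vs3 es3. theta_paths G vs1 es1 vs2 es2 vs3 es3 \<longrightarrow>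
      set es1 \<union> set es2 \<in> X \<longrightarrow> set es1 \<union> set es3 \<in> X \<longrightarrow> set es2 \<union> set es3 \<in> X)"

lemma linear_classD:
  "linear_class G X \<Longrightarrow> theta_paths G vs1 es1 vs2 es2 vs3 es3 \<Longrightarrow>
    set es1 \<union> set es2 \<in> X \<Longrightarrow> set es1 \<union> set es3 \<in> X \<Longrightarrow> set es2 \<union> set es3 \<in> X"
  unfolding linear_class_def by blast

lemma linear_class_balanced:
  assumes "is_biased_graph \<Omega>"
  shows "linear_class \<Omega> (balanced \<Omega>)"
  unfolding linear_class_def
proof (intro allI impI)
  fix vs1 es1 vs2 es2 vs3 es3
  assume t: "theta_paths \<Omega> vs1 es1 vs2 es2 vs3 es3"
    and b: "set es1 \<union> set es2 \<in> balanced \<Omega>" "set es1 \<union> set es3 \<in> balanced \<Omega>"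
  let ?T = "set es1 \<union> set es2 \<union> set es3"
  show "set es2 \<union> set es3 \<in> balanced \<Omega>"
  proof (rule ccontr)
    assume n: "set es2 \<union> set es3 \<notin> balanced \<Omega>"
    have "{C \<in> balanced \<Omega>. C \<subseteq> ?T} = {set es1 \<union> set es2, set es1 \<union> set es3}"
      using theta_circles[OF t] assms b n unfolding is_biased_graph_def by blast
    \<comment> \<open>The cardinality is 2 only if the two circles differ; they do, as
      \<open>es2\<close> is nonempty and disjoint from the other paths.\<close>
    moreover have "set es1 \<union> set es2 \<noteq> set es1 \<union> set es3"
    proof -
      have "set es2 \<noteq> {}" "set es2 \<inter> set es1 = {}" "set es2 \<inter> set es3 = {}"
        using t internally_disjoint_nonempty[of \<Omega> vs2 es2 vs3 es3]
        by (auto simp: theta_paths_def internally_disjoint_def)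
      then obtain f where "f \<in> set es2" "f \<notin> set es1" "f \<notin> set es3"
        by (metis disjoint_iff ex_in_conv)
      then show ?thesis
        by auto
    qed
    ultimately have "card {C \<in> balanced \<Omega>. C \<subseteq> ?T} = 2"
      by simp
    then show False
      using assms theta_paths_is_theta[OF t] by (auto simp: is_biased_graph_def)
  qed
qed

text \<open>
  The second path follows the first up to \<open>x\<close>; rerouting the first one along the next segment of the
  second path that avoids it takes place inside a theta graph, one of whose circles lies in \<open>A\<close>.
\<close>

lemma path_exchange:
  assumes X: "linear_class G X" "\<And>C. is_circle G C \<Longrightarrow> C \<subseteq> A \<Longrightarrow> C \<in> X"
    and "e \<notin> A"
    and "circle_walk G (ps @ x # qs) ((es @ fs) @ [e])" "circle_walk G (ps @ x # qs') ((es @ fs') @ [e])"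
    and "length es = length ps" "last (x # qs) = last (x # qs')"
    and "set (es @ fs) \<subseteq> A" "set (es @ fs') \<subseteq> A" "insert e (set (es @ fs)) \<in> X"
  shows "insert e (set (es @ fs')) \<in> X"
  using assms(4-)
proof (induction "length qs'" arbitrary: ps x qs es fs qs' fs' rule: less_induct)
  case less
  have p: "is_path G (ps @ x # qs) (es @ fs)" and p': "is_path G (ps @ x # qs') (es @ fs')"
    and e: "e \<notin> set (es @ fs)"
    using less.prems(1,2) unfolding circle_walk_snoc by auto
  have px: "is_path G (ps @ [x]) es" and q: "is_path G (x # qs) fs" and q': "is_path G (x # qs') fs'"
    using is_path_appendD[OF p less.prems(3)] is_path_appendD[OF p' less.prems(3)] by simp_all
  show ?case
  proof (cases "qs' = []")
    case True
    then have "qs = []"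
      using q less.prems(4) by (cases qs rule: rev_cases) (auto simp: is_path_def)
    with True show ?thesis
      using q q' less.prems(7) by (auto simp: is_path_def)
  next
    case False
    have "qs \<noteq> []"
      using False q' less.prems(4) by (cases qs' rule: rev_cases) (auto simp: is_path_def)
    \<comment> \<open>Both paths end in the same node, so the second one returns to the first;
      \<open>y\<close> is the first node where it does.\<close>
    with False less.prems(4) have "\<exists>y\<in>set qs'. y \<in> set qs"
      by (metis last.simps last_in_set)
    from split_list_first_prop[OF this] obtain as' y bs'
      where qs': "qs' = as' @ y # bs'" and y: "y \<in> set qs" and as': "\<forall>a\<in>set as'. a \<notin> set qs"
      by auto
    obtain as bs where qs: "qs = as @ y # bs"
      using y by (auto simp: in_set_conv_decomp)
    define gs hs gs' hs' where gh: "gs = take (Suc (length as)) fs" "hs = drop (Suc (length as)) fs"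
      "gs' = take (Suc (length as')) fs'" "hs' = drop (Suc (length as')) fs'"
    have fs: "fs = gs @ hs" "length gs = Suc (length as)" "fs' = gs' @ hs'" "length gs' = Suc (length as')"
      using is_path_length[OF q] is_path_length[OF q'] by (simp_all add: gh qs qs')
    have "is_path G ((x # as) @ y # bs) (gs @ hs)" "is_path G ((x # as') @ y # bs') (gs' @ hs')"
      using q q' by (simp_all add: qs qs' fs(1,3))
    then have g: "is_path G (x # as @ [y]) gs" "is_path G (y # bs) hs"
      and g': "is_path G (x # as' @ [y]) gs'" "is_path G (y # bs') hs'"
      using is_path_appendD[of G "x # as" y bs gs hs] is_path_appendD[of G "x # as'" y bs' gs' hs'] fs(2,4)
      by simp_all
    have d: "distinct (ps @ x # as @ y # bs)" "distinct (ps @ x # as' @ y # bs')"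
      using p p' unfolding qs qs' by (simp_all add: is_path_def)
    have as'_disj: "set as' \<inter> set (ps @ x # as @ y # bs) = {}"
      using d as' unfolding qs by auto
    have mid: "circle_walk G ((ps @ x # as') @ y # bs) (((es @ gs') @ hs) @ [e])
      \<and> insert e (set ((es @ gs') @ hs)) \<in> X"
    proof (cases "set gs \<inter> set gs' = {}")
      \<comment> \<open>A common edge of the two segments joins \<open>x\<close> and
        \<open>y\<close>, so both segments consist of it alone and nothing has to be
        rerouted.\<close>
      case False
      then obtain g where gg: "g \<in> set gs" "g \<in> set gs'"
        by blast
      have ge: "ends G g = {x, y}"
      proof -
        have "ends G g \<subseteq> set (x # as @ [y]) \<inter> set (x # as' @ [y])"
          using gg is_path_ends[OF g(1)] is_path_ends[OF g'(1)] by blast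
        also have "\<dots> \<subseteq> {x, y}"
          using as' qs by auto
        finally have "ends G g \<subseteq> {x, y}" .
        moreover have "card (ends G g) = 2" "x \<noteq> y"
          using is_path_card_ends[OF g(1) gg(1)] d by auto
        ultimately show ?thesis
          by (intro card_subset_eq) auto
      qed
      have single: "as = []" if path: "is_path G (x # as @ [y]) gs" "g \<in> set gs" for as gs
      proof (rule ccontr)
        assume "as \<noteq> []"
        then obtain a as2 where as: "as = a # as2"
          by (cases as) auto
        obtain h gs2 where "gs = h # gs2"
          "is_path G (a # as2 @ [y]) gs2" "ends G h = {x, a}" "x \<notin> set (a # as2 @ [y])"
          by (rule is_path_cases[OF path(1)]) (auto simp: as)
        then show False
          using path ge as is_path_ends[of G "a # as2 @ [y]" gs2 g]
          by (auto simp: doubleton_eq_iff is_path_def)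
      qed
      have "as = []" "as' = []"
        using single[OF g(1) gg(1)] single[OF g'(1) gg(2)] by auto
      then have "gs = [g]" "gs' = [g]"
        using fs gg by (auto simp: length_Suc_conv)
      then show ?thesis
        using less.prems(1,7) unfolding qs fs(1) \<open>as = []\<close> \<open>as' = []\<close> by simp
    next
      case True
      have eA: "e \<notin> set gs'"
        using less.prems(6) \<open>e \<notin> A\<close> fs(3) by auto
      \<comment> \<open>An edge of the new segment that lies on the rest of the circle would be a
        loop at \<open>x\<close> or \<open>y\<close>, since the segment avoids all other nodes
        there.\<close>
      have gs'_disj: "set gs' \<inter> insert e (set (es @ gs @ hs)) = {}"
      proof -
        have "h \<notin> set es \<union> set hs" if "h \<in> set gs'" for h
        proof
          assume h: "h \<in> set es \<union> set hs"
          have "ends G h \<subseteq> set (x # as' @ [y])"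
            using is_path_ends[OF g'(1) that] .
          moreover have "ends G h \<subseteq> set (ps @ [x]) \<or> ends G h \<subseteq> set (y # bs)"
            using h is_path_ends[OF px] is_path_ends[OF g(2)] by blast
          moreover have "set (x # as' @ [y]) \<inter> set (ps @ [x]) \<subseteq> {x}"
            and "set (x # as' @ [y]) \<inter> set (y # bs) \<subseteq> {y}"
            using as'_disj d by auto
          ultimately have "ends G h \<subseteq> {x} \<or> ends G h \<subseteq> {y}"
            by blast
          then have "card (ends G h) \<le> 1"
            using card_mono[of "{x}" "ends G h"] card_mono[of "{y}" "ends G h"] by auto
          then show False
            using is_path_card_ends[OF g'(1) that] by simp
        qed
        with True eA show ?thesis
          by auto
      qed
      have cw: "circle_walk G (ps @ x # as @ y # bs) ((es @ gs @ hs) @ [e])"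
        using less.prems(1) by (simp add: qs fs(1))
      have t: "theta_paths G (x # as @ [y]) gs (rev (y # bs @ ps @ [x])) (rev (hs @ e # es)) (x # as' @ [y]) gs'"
        by (rule chord_theta[OF cw less.prems(3) fs(2) g'(1) as'_disj gs'_disj])
      have "set gs \<union> set gs' \<in> X"
      proof (rule X(2))
        show "is_circle G (set gs \<union> set gs')"
          using t by (auto simp: theta_paths_def intro: internally_disjoint_is_circle)
        show "set gs \<union> set gs' \<subseteq> A"
          using less.prems(5,6) by (auto simp: fs)
      qed
      moreover have "set gs \<union> set (rev (hs @ e # es)) = insert e (set (es @ fs))"
        by (auto simp: fs)
      ultimately have "set (rev (hs @ e # es)) \<union> set gs' \<in> X"
        using linear_classD[OF X(1) t] less.prems(7) by simp
      moreover have "set (rev (hs @ e # es)) \<union> set gs' = insert e (set ((es @ gs') @ hs))"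
        by auto
      moreover have "circle_walk G ((ps @ x # as') @ y # bs) (((es @ gs') @ hs) @ [e])"
      proof -
        have "is_path G (ps @ x # as' @ [y]) (es @ gs')"
          using px g'(1) d less.prems(3) by (subst is_path_append) auto
        then have "is_path G ((ps @ x # as') @ y # bs) ((es @ gs') @ hs)"
          using g(2) less.prems(3) fs(4) d as'_disj by (subst is_path_append) auto
        then show ?thesis
          using cw eA e unfolding circle_walk_snoc by (auto simp: hd_append fs(1))
      qed
      ultimately show ?thesis
        by simp
    qed
    \<comment> \<open>The common initial part now reaches \<open>y\<close>, so a shorter piece of
      the second path remains.\<close>
    have "insert e (set ((es @ gs') @ hs')) \<in> X"
    proof (rule less.hyps[of bs' "ps @ x # as'" y bs "es @ gs'" hs hs'])
      show "length bs' < length qs'"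
        by (simp add: qs')
      show "circle_walk G ((ps @ x # as') @ y # bs') (((es @ gs') @ hs') @ [e])"
        using less.prems(2) by (simp add: qs' fs)
      show "length (es @ gs') = length (ps @ x # as')"
        using less.prems(3) fs(4) by simp
      show "last (y # bs) = last (y # bs')"
        using less.prems(4) by (simp add: qs qs')
      show "set ((es @ gs') @ hs) \<subseteq> A" "set ((es @ gs') @ hs') \<subseteq> A"
        using less.prems(5,6) by (auto simp: fs)
    qed (use mid in auto)
    then show ?thesis
      by (simp add: fs)
  qed
qed

text \<open>Two circles through the new edge \<open>e\<close> consist of \<open>e\<close> and two
  paths of \<open>A\<close> with the same ends, and \<open>path_exchange\<close> leads from one to
  the other. This step drives both inductions over the edges: the one for a balanced lift and the
  one for a good labelling.\<close>

lemma linear_class_extend: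
  assumes X: "linear_class G X" "\<And>C. is_circle G C \<Longrightarrow> C \<subseteq> A \<Longrightarrow> C \<in> X"
    and C0: "is_circle G C0" "e \<in> C0" "C0 \<subseteq> insert e A" "C0 \<in> X"
    and C: "is_circle G C" "C \<subseteq> insert e A"
  shows "C \<in> X"
proof (cases "e \<in> C \<and> e \<notin> A")
  case False
  then show ?thesis
    using X(2) C by blast
next
  case True
  obtain vs es where w: "circle_walk G vs (es @ [e])" "C0 = insert e (set es)"
    using is_circle_through[OF C0(1,2)] by blast
  obtain vs1 es1 where w1: "circle_walk G vs1 (es1 @ [e])" "C = insert e (set es1)"
    using is_circle_through[OF C(1)] True by blast
  have "{last vs, hd vs} = {last vs1, hd vs1}"
    using w(1) w1(1) by (simp add: circle_walk_snoc)
  \<comment> \<open>If necessary the second walk is reversed, so that both paths leave from the same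
    end of \<open>e\<close>.\<close>
  then have "hd vs1 = hd vs \<and> last vs1 = last vs \<or> hd vs1 = last vs \<and> last vs1 = hd vs"
    by (auto simp: doubleton_eq_iff)
  moreover have "vs1 \<noteq> []"
    using w1(1) by (auto simp: circle_walk_def)
  ultimately obtain vs2 es2 where w2: "circle_walk G vs2 (es2 @ [e])" "C = insert e (set es2)"
    "hd vs2 = hd vs" "last vs2 = last vs"
    using w1 circle_walk_rev[OF w1(1)] by (metis hd_rev last_rev set_rev)
  have ne: "vs \<noteq> []" "vs2 \<noteq> []"
    using w(1) w2(1) by (auto simp: circle_walk_def)
  have e: "e \<notin> set es" "e \<notin> set es2"
    using w(1) w2(1) by (auto simp: circle_walk_snoc)
  have "insert e (set ([] @ es2)) \<in> X"
  proof (rule path_exchange[where A = A and ps = "[]" and es = "[]" and fs = es])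
    show "circle_walk G ([] @ hd vs # tl vs) (([] @ es) @ [e])"
      using w(1) ne by simp
    show "circle_walk G ([] @ hd vs # tl vs2) (([] @ es2) @ [e])"
      using w2(1) ne by (simp flip: w2(3))
    show "last (hd vs # tl vs) = last (hd vs # tl vs2)"
      using ne w2(3,4) by (metis list.collapse)
  qed (use X True w(2) w2(2) C0 C e in auto)
  then show ?thesis
    by (simp add: w2(2))
qed

section \<open>Lifts of circles\<close>

text \<open>After rotation \<open>f'\<close> closes a path that contains \<open>f\<close> and has
  the same ends as \<open>f\<close>, so the path is \<open>f\<close> alone. Thus a circle that uses
  a fiber twice is a digon.\<close>

lemma circle_walk_parallel:
  assumes c: "circle_walk G vs fs" and f: "f \<in> set fs" "f' \<in> set fs" "f \<noteq> f'" "ends G f = ends G f'"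
  shows "set fs = {f, f'}"
proof -
  obtain n es where n: "rotate n fs = es @ [f']" "circle_walk G (rotate n vs) (es @ [f'])"
    using circle_walk_through[OF c f(2)] by blast
  define us where "us = rotate n vs"
  have set_fs: "set fs = insert f' (set es)"
    using arg_cong[OF n(1), of set] by simp
  have p: "is_path G us es" and e: "ends G f' = {last us, hd us}"
    using n(2) by (auto simp: circle_walk_snoc us_def)
  have "f \<in> set es"
    using f set_fs by auto
  have "card (ends G f) = 2"
    using is_path_card_ends[OF p \<open>f \<in> set es\<close>] .
  then have ne: "hd us \<noteq> last us"
    using e f(4) by auto
  have "f = hd es"
    using is_path_hd_edge(3)[OF p ne \<open>f \<in> set es\<close>] e f(4) by auto
  with \<open>f \<in> set es\<close> obtain es' where es: "es = f # es'"
    by (cases es) auto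
  obtain v w ws where us: "us = v # w # ws" "ends G f = {v, w}" "v \<notin> set (w # ws)" "is_path G (w # ws) es'"
    by (rule is_path_cases[OF p]) (auto simp: es)
  then have "last (w # ws) = w"
    using e f(4) by (auto simp: doubleton_eq_iff split: if_splits)
  then have "ws = []"
    using us(4) by (cases ws rule: rev_cases) (auto simp: is_path_def)
  then have "es' = []"
    using is_path_length[OF us(4)] by simp
  then show ?thesis
    using set_fs es by auto
qed

locale expansion =
  fixes \<Delta> :: "('v, 'e) graph" and \<Omega> :: "('v, 'f) biased_graph" and p :: "'f \<Rightarrow> 'e"
  assumes expansion: "biased_expansion \<Delta> \<Omega> p"
begin

text \<open>An edge is chosen over every edge of \<open>\<Delta>\<close> and not just over one
  circle: altering a lifted circle is then a function update, and one lift serves all circles of a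
  theta graph. Off the edges of \<open>\<Delta>\<close> the values are arbitrary.\<close>

definition lift :: "('e \<Rightarrow> 'f) \<Rightarrow> bool" where
  "lift \<sigma> \<longleftrightarrow> (\<forall>e\<in>edges \<Delta>. \<sigma> e \<in> fiber \<Omega> p e)"

abbreviation bal :: "('e \<Rightarrow> 'f) \<Rightarrow> 'e set \<Rightarrow> bool" where
  "bal \<sigma> C \<equiv> \<sigma> ` C \<in> balanced \<Omega>"

lemma liftD: "lift \<sigma> \<Longrightarrow> e \<in> edges \<Delta> \<Longrightarrow> \<sigma> e \<in> fiber \<Omega> p e"
  by (simp add: lift_def)

lemma lift_upd: "lift \<sigma> \<Longrightarrow> f \<in> fiber \<Omega> p e \<Longrightarrow> lift (\<sigma>(e := f))"
  by (simp add: lift_def)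

lemma nodes_eq [simp]: "nodes \<Omega> = nodes \<Delta>"
  and proj_edges: "p ` edges \<Omega> = edges \<Delta>"
  and edge_proj: "f \<in> edges \<Omega> \<Longrightarrow> p f \<in> edges \<Delta>"
  and ends_proj: "f \<in> edges \<Omega> \<Longrightarrow> ends \<Omega> f = ends \<Delta> (p f)"
  and biased: "is_biased_graph \<Omega>"
  using expansion by (auto simp: biased_expansion_def)

lemma ex_lift: "\<exists>\<sigma>. lift \<sigma>"
proof -
  have "\<forall>e\<in>edges \<Delta>. \<exists>f. f \<in> fiber \<Omega> p e"
    by (auto simp: fiber_def proj_edges[symmetric])
  then show ?thesis
    unfolding lift_def by metis
qed

lemma lift_proj: "lift \<sigma> \<Longrightarrow> e \<in> edges \<Delta> \<Longrightarrow> \<sigma> e \<in> edges \<Omega> \<and> p (\<sigma> e) = e"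
  by (auto simp: lift_def fiber_def)

lemma lift_path:
  assumes "lift \<sigma>" "is_path \<Delta> vs es"
  shows "is_path \<Omega> vs (map \<sigma> es)"
proof -
  have "es ! i \<in> edges \<Delta>" if "i < length es" for i
    using assms(2) that by (auto simp: is_path_def)
  then show ?thesis
    using assms by (auto simp: is_path_def ends_proj lift_proj)
qed

lemma lift_internally_disjoint:
  assumes "lift \<sigma>" "internally_disjoint \<Delta> vs es vs' es'"
  shows "internally_disjoint \<Omega> vs (map \<sigma> es) vs' (map \<sigma> es')"
proof -
  have "set es \<subseteq> edges \<Delta>" "set es' \<subseteq> edges \<Delta>"
    using assms(2) by (auto simp: internally_disjoint_def is_path_def)
  then have "set (map \<sigma> es) \<inter> set (map \<sigma> es') = {}"
    using assms by (auto simp: internally_disjoint_def) (metis disjoint_iff lift_proj subsetD)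
  then show ?thesis
    using assms by (auto simp: internally_disjoint_def lift_path)
qed

lemma linear_class_bal:
  assumes "lift \<sigma>"
  shows "linear_class \<Delta> {C. bal \<sigma> C}"
  unfolding linear_class_def
proof (intro allI impI)
  fix vs1 es1 vs2 es2 vs3 es3
  assume t: "theta_paths \<Delta> vs1 es1 vs2 es2 vs3 es3"
    and b: "set es1 \<union> set es2 \<in> {C. bal \<sigma> C}" "set es1 \<union> set es3 \<in> {C. bal \<sigma> C}"
  have "theta_paths \<Omega> vs1 (map \<sigma> es1) vs2 (map \<sigma> es2) vs3 (map \<sigma> es3)"
    using t assms by (simp add: theta_paths_def lift_internally_disjoint)
  from linear_classD[OF linear_class_balanced[OF biased] this] b
  show "set es2 \<union> set es3 \<in> {C. bal \<sigma> C}"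
    by (simp add: image_Un)
qed

lemma theta_bal_iff:
  assumes "lift \<sigma>" "theta_paths \<Delta> vs1 es1 vs2 es2 vs3 es3" "bal \<sigma> (set es1 \<union> set es2)"
  shows "bal \<sigma> (set es1 \<union> set es3) \<longleftrightarrow> bal \<sigma> (set es2 \<union> set es3)"
proof
  show "bal \<sigma> (set es1 \<union> set es3) \<Longrightarrow> bal \<sigma> (set es2 \<union> set es3)"
    using linear_classD[OF linear_class_bal[OF assms(1)] assms(2)] assms(3) by simp
  have "theta_paths \<Delta> vs2 es2 vs1 es1 vs3 es3"
    using theta_paths_swap[OF theta_paths_rotate[OF assms(2)]] .
  from linear_classD[OF linear_class_bal[OF assms(1)] this]
  show "bal \<sigma> (set es2 \<union> set es3) \<Longrightarrow> bal \<sigma> (set es1 \<union> set es3)"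
    using assms(3) by (simp add: Un_commute)
qed

lemma circle_walk_lifting:
  assumes "circle_walk \<Delta> vs es" "list_all2 (\<lambda>f e. f \<in> fiber \<Omega> p e) fs (butlast es)"
  shows "\<exists>!f. f \<in> fiber \<Omega> p (last es) \<and> set (fs @ [f]) \<in> balanced \<Omega>"
proof -
  have "\<forall>vs es fs. circle_walk \<Delta> vs es \<and> list_all2 (\<lambda>f e. f \<in> fiber \<Omega> p e) fs (butlast es) \<longrightarrow>
      (\<exists>!f. f \<in> fiber \<Omega> p (last es) \<and> set (fs @ [f]) \<in> balanced \<Omega>)"
    using expansion unfolding biased_expansion_def by (elim conjE)
  from this[rule_format, OF conjI[OF assms]] show ?thesis .
qed

text \<open>Rotation makes any edge of the circle the last one, so the lifting property is available
  at every edge.\<close>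

lemma circle_lifting:
  assumes C: "is_circle \<Delta> C" "e \<in> C" and "lift \<sigma>"
  shows "\<exists>!f. f \<in> fiber \<Omega> p e \<and> bal (\<sigma>(e := f)) C"
proof -
  obtain vs es where w: "circle_walk \<Delta> vs (es @ [e])" "C = insert e (set es)"
    using is_circle_through[OF C] by blast
  have "set es \<subseteq> edges \<Delta>" and e: "e \<notin> set es"
    using w(1) by (auto simp: circle_walk_snoc is_path_def)
  then have "list_all2 (\<lambda>f e. f \<in> fiber \<Omega> p e) (map \<sigma> es) es"
    using assms(3) nth_mem by (fastforce simp: list_all2_conv_all_nth lift_def)
  then have "\<exists>!f. f \<in> fiber \<Omega> p e \<and> set (map \<sigma> es @ [f]) \<in> balanced \<Omega>"
    using circle_walk_lifting[OF w(1), of "map \<sigma> es"] by simp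
  moreover have "(\<sigma>(e := f)) ` C = set (map \<sigma> es @ [f])" for f
    using e by (auto simp: w(2))
  ultimately show ?thesis
    by simp
qed

lemma bal_cong: "(\<And>g. g \<in> C \<Longrightarrow> \<sigma> g = \<tau> g) \<Longrightarrow> bal \<sigma> C \<longleftrightarrow> bal \<tau> C"
  by (simp cong: image_cong)

text \<open>This is the Latin property of balanced lifts: exchanging a single edge within its fiber
  destroys balance.\<close>

lemma bal_unique:
  assumes "is_circle \<Delta> C" "e \<in> C" "lift \<sigma>" "lift \<tau>"
    and "\<And>g. g \<in> C \<Longrightarrow> g \<noteq> e \<Longrightarrow> \<sigma> g = \<tau> g" and "bal \<sigma> C" "bal \<tau> C"
  shows "\<sigma> e = \<tau> e"
proof -
  have "e \<in> edges \<Delta>"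
    using assms(1,2) is_circle_edges by blast
  moreover have "bal (\<sigma>(e := \<tau> e)) C \<longleftrightarrow> bal \<tau> C"
    by (rule bal_cong) (use assms(5) in auto)
  ultimately show ?thesis
    using circle_lifting[OF assms(1-3)] assms(6,7) liftD[OF assms(3), of e] liftD[OF assms(4), of e]
    by (metis fun_upd_triv)
qed

text \<open>Only the lift of the new edge is chosen anew, so the circles of \<open>A\<close> stay
  balanced. The choice that balances one circle through \<open>e\<close> balances all of them by
  \<open>linear_class_extend\<close>.\<close>

lemma ex_balanced_lift:
  assumes "finite (edges \<Delta>)"
  obtains s where "lift s" "\<And>C. is_circle \<Delta> C \<Longrightarrow> bal s C"
proof -
  have "\<exists>s. lift s \<and> (\<forall>C. is_circle \<Delta> C \<and> C \<subseteq> A \<longrightarrow> bal s C)" if "A \<subseteq> edges \<Delta>" for A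
    using finite_subset[OF that assms] that
  proof (induction A rule: finite_induct)
    case empty
    then show ?case
      using ex_lift is_circle_nonempty by blast
  next
    case (insert e A)
    then obtain s where s: "lift s" "\<And>C. is_circle \<Delta> C \<Longrightarrow> C \<subseteq> A \<Longrightarrow> bal s C"
      by auto
    show ?case
    proof (cases "\<exists>C0. is_circle \<Delta> C0 \<and> e \<in> C0 \<and> C0 \<subseteq> insert e A")
      case False
      then have "bal s C" if "is_circle \<Delta> C" "C \<subseteq> insert e A" for C
        using s(2)[OF that(1)] that by blast
      then show ?thesis
        using s(1) by blast
    next
      case True
      then obtain C0 where C0: "is_circle \<Delta> C0" "e \<in> C0" "C0 \<subseteq> insert e A"
        by blast
      then obtain f where f: "f \<in> fiber \<Omega> p e" "bal (s(e := f)) C0"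
        using circle_lifting[OF C0(1,2) s(1)] by blast
      have l: "lift (s(e := f))"
        using s(1) f(1) by (rule lift_upd)
      have A: "bal (s(e := f)) C" if "is_circle \<Delta> C" "C \<subseteq> A" for C
      proof -
        have "bal (s(e := f)) C \<longleftrightarrow> bal s C"
          by (rule bal_cong) (use that(2) insert.hyps(2) in auto)
        then show ?thesis
          using s(2)[OF that] by simp
      qed
      have "bal (s(e := f)) C" if "is_circle \<Delta> C" "C \<subseteq> insert e A" for C
        using linear_class_extend[OF linear_class_bal[OF l] _ C0 _ that] A f(2) by simp
      then show ?thesis
        using l by blast
    qed
  qed
  from this[OF order_refl] show ?thesis
    using that is_circle_edges by blast
qed

section \<open>From labels of the fibers to an isomorphism\<close>

lemma lift_through:
  assumes "set fs \<subseteq> edges \<Omega>" "distinct (map p fs)"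
  obtains \<sigma> where "lift \<sigma>" "map \<sigma> (map p fs) = fs"
proof -
  obtain \<tau> where \<tau>: "lift \<tau>"
    using ex_lift by blast
  \<comment> \<open>Over the given edges \<open>p\<close> is inverted; elsewhere an arbitrary lift
    serves as default.\<close>
  define \<sigma> where "\<sigma> e = (if e \<in> p ` set fs then the_inv_into (set fs) p e else \<tau> e)" for e
  have inj: "inj_on p (set fs)"
    using assms(2) by (simp add: distinct_map)
  have *: "\<sigma> (p f) = f" if "f \<in> set fs" for f
    using that inj by (simp add: \<sigma>_def the_inv_into_f_f)
  have "\<sigma> e \<in> fiber \<Omega> p e" if "e \<in> edges \<Delta>" for e
  proof (cases "e \<in> p ` set fs")
    case True
    then show ?thesis
      using * assms(1) by (auto simp: fiber_def)
  next
    case False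
    then show ?thesis
      using liftD[OF \<tau> that] by (simp add: \<sigma>_def)
  qed
  then show ?thesis
    using that[of \<sigma>] * by (simp add: lift_def map_idI)
qed

text \<open>A balanced circle of either graph never uses a fiber twice, so it projects to a circle
  of \<open>\<Delta>\<close> and is part of a lift. Hence labels that describe balance over the
  circles of \<open>\<Delta>\<close> already give an isomorphism.\<close>

lemma isomorphic_group_expansion:
  fixes G :: "('g, 'm) monoid_scheme"
  assumes "group G" and orient: "orientation \<Delta> tail"
    and lab: "\<And>e. e \<in> edges \<Delta> \<Longrightarrow> bij_betw lab (fiber \<Omega> p e) (carrier G)"
    and good: "\<And>\<sigma> vs es. lift \<sigma> \<Longrightarrow> circle_walk \<Delta> vs es \<Longrightarrow>
      bal \<sigma> (set es) \<longleftrightarrow> gain_product G tail vs (map (\<lambda>e. (lab (\<sigma> e), e)) es) = \<one>\<^bsub>G\<^esub>"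
  shows "expansion_isomorphic \<Omega> p (group_expansion G \<Delta> tail) snd"
proof -
  interpret group G by fact
  define \<phi> where "\<phi> f = (lab f, p f)" for f
  let ?H = "expanded_graph G \<Delta>"
  have bij: "bij_betw \<phi> (edges \<Omega>) (carrier G \<times> edges \<Delta>)"
  proof (rule bij_betwI')
    fix f f' assume "f \<in> edges \<Omega>" "f' \<in> edges \<Omega>"
    then show "\<phi> f = \<phi> f' \<longleftrightarrow> f = f'"
      using bij_betw_imp_inj_on[OF lab[OF edge_proj, of f]]
      by (auto simp: \<phi>_def fiber_def inj_on_def)
  next
    fix f assume "f \<in> edges \<Omega>"
    then show "\<phi> f \<in> carrier G \<times> edges \<Delta>"
      using bij_betwE[OF lab[OF edge_proj, of f]] edge_proj[of f] by (auto simp: \<phi>_def fiber_def)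
  next
    fix y assume "y \<in> carrier G \<times> edges \<Delta>"
    then obtain g e where y: "y = (g, e)" "g \<in> carrier G" "e \<in> edges \<Delta>"
      by auto
    then obtain f where "f \<in> fiber \<Omega> p e" "lab f = g"
      using lab[of e] by (metis bij_betw_imp_surj_on imageE)
    then show "\<exists>f\<in>edges \<Omega>. y = \<phi> f"
      by (auto simp: \<phi>_def y fiber_def intro!: bexI[of _ f])
  qed
  have walk: "set fs \<in> balanced \<Omega> \<longleftrightarrow> gain_product G tail vs (map \<phi> fs) = \<one>\<^bsub>G\<^esub>"
    if w: "circle_walk \<Delta> vs (map p fs)" "set fs \<subseteq> edges \<Omega>" for vs fs
  proof -
    have "distinct (map p fs)"
      using w(1) by (simp add: circle_walk_def)
    then obtain \<sigma> where \<sigma>: "lift \<sigma>" "map \<sigma> (map p fs) = fs"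
      using lift_through[OF w(2)] by blast
    have "\<sigma> ` set (map p fs) = set fs"
      using arg_cong[OF \<sigma>(2), of set] by (simp add: image_image)
    moreover have "\<sigma> (p f) = f" if "f \<in> set fs" for f
      using \<sigma>(2) that map_eq_conv[of "\<sigma> \<circ> p" fs id] by simp
    then have "map (\<lambda>e. (lab (\<sigma> e), e)) (map p fs) = map \<phi> fs"
      by (simp add: \<phi>_def)
    ultimately show ?thesis
      using good[OF \<sigma>(1) w(1)] by metis
  qed
  have proj: "circle_walk \<Delta> vs (map p fs) \<longleftrightarrow> circle_walk \<Omega> vs fs"
    "circle_walk ?H vs (map \<phi> fs) \<longleftrightarrow> circle_walk \<Omega> vs fs"
    if fs: "set fs \<subseteq> edges \<Omega>" "distinct (map p fs)" for vs fs
  proof -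
    have in_edges: "fs ! i \<in> edges \<Omega>" if "i < length fs" for i
      using fs(1) that by auto
    have d: "distinct fs" "distinct (map \<phi> fs)"
      using fs(2) by (auto simp: distinct_map \<phi>_def inj_on_def)
    have s: "set (map p fs) \<subseteq> edges \<Delta>" "set (map \<phi> fs) \<subseteq> carrier G \<times> edges \<Delta>"
      unfolding set_map using fs(1) edge_proj bij_betwE[OF bij] by blast+
    show "circle_walk \<Delta> vs (map p fs) \<longleftrightarrow> circle_walk \<Omega> vs fs"
      "circle_walk ?H vs (map \<phi> fs) \<longleftrightarrow> circle_walk \<Omega> vs fs"
      using fs d s in_edges by (auto simp: circle_walk_def expanded_graph_def ends_proj \<phi>_def)
  qed
  have "C \<in> balanced \<Omega> \<longleftrightarrow> \<phi> ` C \<in> balanced (group_expansion G \<Delta> tail)" if C: "C \<subseteq> edges \<Omega>" for C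
  proof
    assume b: "C \<in> balanced \<Omega>"
    then obtain vs fs where fs: "circle_walk \<Omega> vs fs" "C = set fs"
      using biased by (auto simp: is_biased_graph_def is_circle_def)
    \<comment> \<open>Two edges of one fiber are parallel, so the circle would be a balanced digon
      inside that fiber.\<close>
    have d: "distinct (map p fs)"
    proof (rule ccontr)
      assume "\<not> ?thesis"
      then obtain f f' where f: "f \<in> set fs" "f' \<in> set fs" "f \<noteq> f'" "p f = p f'"
        using fs(1) by (auto simp: distinct_map circle_walk_def inj_on_def)
      moreover have "f \<in> edges \<Omega>" "f' \<in> edges \<Omega>"
        using f C fs(2) by auto
      ultimately have "C = {f, f'}"
        using circle_walk_parallel[OF fs(1) f(1-3)] fs(2) by (simp add: ends_proj)
      moreover have "{f, f'} \<notin> balanced \<Omega>"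
        using expansion f(3,4) \<open>f \<in> edges \<Omega>\<close> \<open>f' \<in> edges \<Omega>\<close> edge_proj
        unfolding biased_expansion_def fiber_def by blast
      ultimately show False
        using b by simp
    qed
    have "circle_walk ?H vs (map \<phi> fs)" "gain_product G tail vs (map \<phi> fs) = \<one>\<^bsub>G\<^esub>"
      using proj[OF _ d] walk[of vs fs] fs b C by auto
    moreover have "\<phi> ` C = set (map \<phi> fs)"
      using fs(2) by simp
    ultimately show "\<phi> ` C \<in> balanced (group_expansion G \<Delta> tail)"
      unfolding group_expansion_def by (simp del: set_map) blast
  next
    assume "\<phi> ` C \<in> balanced (group_expansion G \<Delta> tail)"
    then obtain vs gs where gs: "circle_walk ?H vs gs" "\<phi> ` C = set gs" "gain_product G tail vs gs = \<one>\<^bsub>G\<^esub>"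
      by (auto simp: group_expansion_def)
    have gsE: "set gs \<subseteq> carrier G \<times> edges \<Delta>"
      using gs(1) by (auto simp: circle_walk_def expanded_graph_def)
    define fs where "fs = map (inv_into (edges \<Omega>) \<phi>) gs"
    have map_fs: "map \<phi> fs = gs"
      unfolding fs_def map_map using gsE bij_betw_inv_into_right[OF bij] by (auto intro!: map_idI)
    have fsE: "set fs \<subseteq> edges \<Omega>"
      using gsE bij_betwE[OF bij_betw_inv_into[OF bij]] by (auto simp: fs_def)
    have "\<phi> ` set fs = \<phi> ` C"
      using map_fs gs(2) by (metis set_map)
    then have fsC: "set fs = C"
      using fsE C bij_betw_imp_inj_on[OF bij] by (metis inj_on_image_eq_iff)
    have snd: "map p fs = map snd gs"
      unfolding map_fs[symmetric] by (simp add: \<phi>_def)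
    have d: "distinct (map p fs)"
    proof (rule ccontr)
      assume "\<not> ?thesis"
      then obtain f f' where f: "f \<in> set gs" "f' \<in> set gs" "f \<noteq> f'" "snd f = snd f'"
        using gs(1) unfolding snd by (auto simp: distinct_map circle_walk_def inj_on_def)
      then have e2: "set gs = {f, f'}"
        using circle_walk_parallel[OF gs(1) f(1-3)] by (simp add: expanded_graph_def case_prod_unfold)
      moreover have dgs: "distinct gs" "length vs = length gs" "distinct vs"
        using gs(1) by (auto simp: circle_walk_def)
      ultimately have "length gs = 2"
        using f(3) distinct_card[of gs] by simp
      then obtain a b v w where ab: "gs = [a, b]" "vs = [v, w]"
        using dgs(2) by (auto simp: length_Suc_conv numeral_2_eq_2)
      then have "a \<noteq> b" "snd a = snd b"
        using e2 f(3,4) dgs by (auto simp: doubleton_eq_iff)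
      then obtain g h e where gh: "a = (g, e)" "b = (h, e)" "g \<noteq> h"
        by (metis prod.collapse)
      have in_G: "g \<in> carrier G" "h \<in> carrier G" "e \<in> edges \<Delta>"
        using gsE ab gh by auto
      have "ends \<Delta> e = {v, w}" "v \<noteq> w"
        using gs(1) dgs ab gh by (auto simp: circle_walk_def expanded_graph_def)
      \<comment> \<open>Both edges of the digon have the same tail, so exactly one of them is
        traversed from it: one group element enters the product inverted and the other does
        not.\<close>
      then have "tail e = v \<and> tail e \<noteq> w \<or> tail e = w \<and> tail e \<noteq> v"
        using orient in_G(3) by (auto simp: orientation_def)
      then have "g \<otimes>\<^bsub>G\<^esub> inv\<^bsub>G\<^esub> h = \<one>\<^bsub>G\<^esub> \<or> inv\<^bsub>G\<^esub> g \<otimes>\<^bsub>G\<^esub> h = \<one>\<^bsub>G\<^esub>"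
        using gs(3) in_G(1,2) unfolding ab gh by (auto simp: gain_product_def gain_def)
      then show False
        using gh(3) in_G(1,2) by (metis inv_equality inv_closed inv_inv)
    qed
    have "circle_walk \<Omega> vs fs"
      using proj(2)[OF fsE d] gs(1) map_fs by auto
    then show "C \<in> balanced \<Omega>"
      using walk[of vs fs] proj(1)[OF fsE d] fsE gs(3) map_fs fsC by auto
  qed
  moreover have "nodes (group_expansion G \<Delta> tail) = nodes \<Delta>"
    "edges (group_expansion G \<Delta> tail) = carrier G \<times> edges \<Delta>"
    "ends (group_expansion G \<Delta> tail) (\<phi> f) = ends \<Delta> (p f)" "snd (\<phi> f) = p f" for f
    by (simp_all add: group_expansion_def \<phi>_def)
  ultimately show ?thesis
    unfolding expansion_isomorphic_def using bij ends_proj by (intro conjI exI[of _ \<phi>]) auto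
qed

end

section \<open>Signed sums along walks\<close>

text \<open>The gain product in additive notation, with integers instead of group elements so that
  it serves both groups. Since \<open>zip\<close> drops a surplus node, it applies to paths as well
  as to circle walks.\<close>

definition wsum :: "('e \<Rightarrow> 'v) \<Rightarrow> ('e \<Rightarrow> int) \<Rightarrow> 'v list \<Rightarrow> 'e list \<Rightarrow> int" where
  "wsum tail x vs es = (\<Sum>(v, e)\<leftarrow>zip vs es. if tail e = v then x e else - x e)"

lemma wsum_Nil [simp]: "wsum tail x vs [] = 0"
  and wsum_Cons [simp]:
    "wsum tail x (v # vs) (e # es) = (if tail e = v then x e else - x e) + wsum tail x vs es"
  by (simp_all add: wsum_def)

lemma wsum_append:
  "length vs = length es \<Longrightarrow>
    wsum tail x (vs @ vs') (es @ es') = wsum tail x vs es + wsum tail x vs' es'"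
  by (simp add: wsum_def)

lemma wsum_trunc: "length vs = length es \<Longrightarrow> wsum tail x (vs @ vs') es = wsum tail x vs es"
  using wsum_append[of vs es tail x vs' "[]"] by simp

lemma wsum_snoc:
  assumes "length vs = Suc (length es)"
  shows "wsum tail x vs (es @ [e]) = wsum tail x vs es + (if tail e = last vs then x e else - x e)"
proof -
  obtain us z where "vs = us @ [z]"
    using assms by (cases vs rule: rev_cases) auto
  with assms show ?thesis
    by (simp add: wsum_append wsum_trunc)
qed

lemma wsum_rotate:
  assumes "length vs = length es"
  shows "wsum tail x (rotate n vs) (rotate n es) = wsum tail x vs es"
proof -
  let ?m = "n mod length es"
  have "wsum tail x (rotate n vs) (rotate n es) =
      wsum tail x (drop ?m vs) (drop ?m es) + wsum tail x (take ?m vs) (take ?m es)"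
    using assms by (simp add: rotate_drop_take wsum_append)
  also have "\<dots> = wsum tail x (take ?m vs @ drop ?m vs) (take ?m es @ drop ?m es)"
    using assms by (subst wsum_append) auto
  finally show ?thesis
    by simp
qed

lemma wsum_rev:
  assumes "is_path G vs es" "orientation G tail"
  shows "wsum tail x (rev vs) (rev es) = - wsum tail x vs es"
  using assms(1)
proof (induction es arbitrary: vs)
  case (Cons e es)
  obtain v w ws where vs: "vs = v # w # ws" and p: "is_path G (w # ws) es"
    and e: "e \<in> edges G" "ends G e = {v, w}" "v \<notin> set (w # ws)"
    by (rule is_path_cases[OF Cons.prems]) auto
  have len: "length ws = length es"
    using is_path_length[OF p] by simp
  have "tail e = v \<or> tail e = w"
    using assms(2) e(1,2) by (auto simp: orientation_def)
  moreover have "wsum tail x (rev ws) (rev es) = - wsum tail x (w # ws) es"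
    using Cons.IH[OF p] len by (simp add: wsum_trunc)
  ultimately show ?case
    using e(3) len by (auto simp: vs wsum_append)
qed simp

lemma wsum_cong:
  assumes "\<And>e. e \<in> set es \<Longrightarrow> x e = y e"
  shows "wsum tail x vs es = wsum tail y vs es"
  unfolding wsum_def using assms
  by (intro arg_cong[of _ _ sum_list] map_cong refl) (auto dest: set_zip_rightD)

text \<open>The coefficients are the same for all \<open>x\<close>, so the sum is a linear form in
  which the label of a single edge can be isolated.\<close>

lemma wsum_signs:
  assumes "distinct es" "length es \<le> length vs"
  obtains c where "\<And>e. c e = 1 \<or> c e = (-1::int)" "\<And>x. wsum tail x vs es = (\<Sum>e\<in>set es. c e * x e)"
  using assms
proof (induction es arbitrary: vs thesis)
  case Nil
  show ?case
    by (rule Nil(1)[of "\<lambda>_. 1"]) auto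
next
  case (Cons e es)
  obtain v vs' where vs: "vs = v # vs'"
    using Cons.prems(3) by (cases vs) auto
  obtain c where c: "\<And>e. c e = 1 \<or> c e = (-1::int)" "\<And>x. wsum tail x vs' es = (\<Sum>e\<in>set es. c e * x e)"
    using Cons.IH[of vs'] Cons.prems(2,3) vs by auto
  define c' where "c' = c(e := if tail e = v then 1 else -1)"
  have "(\<Sum>e\<in>set es. c' e * x e) = (\<Sum>e\<in>set es. c e * x e)" for x
    by (rule sum.cong) (use Cons.prems(2) in \<open>auto simp: c'_def\<close>)
  then have "wsum tail x vs (e # es) = (\<Sum>e\<in>set (e # es). c' e * x e)" for x
    using Cons.prems(2) by (simp add: vs c(2)) (simp add: c'_def)
  then show ?case
    using c(1) by (intro Cons.prems(1)[of c']) (auto simp: c'_def)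
qed

text \<open>With the same edge rotated to the end of both walks, there remain two paths with equal
  edge sets and the same pair of ends. They coincide or are reverse to each other, and reversal
  negates the sum.\<close>

lemma circle_walk_wsum_unique:
  assumes w: "circle_walk G vs es" "circle_walk G vs' es'" "set es = set es'"
    and orient: "orientation G tail"
  shows "(\<forall>x. wsum tail x vs' es' = wsum tail x vs es) \<or> (\<forall>x. wsum tail x vs' es' = - wsum tail x vs es)"
proof -
  obtain es1 e where es: "es = es1 @ [e]"
    using w(1) by (cases es rule: rev_cases) (auto simp: circle_walk_def)
  obtain n es2 where n: "rotate n es' = es2 @ [e]" "circle_walk G (rotate n vs') (es2 @ [e])"
    using circle_walk_through[OF w(2), of e] w(3) es by auto
  define us where "us = rotate n vs'"
  have rot: "wsum tail x us (es2 @ [e]) = wsum tail x vs' es'" for x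
    using wsum_rotate[of vs' es' tail x n] w(2) n(1) by (simp add: us_def circle_walk_def)
  have p1: "is_path G vs es1" "e \<notin> set es1" "ends G e = {last vs, hd vs}" "e \<in> edges G"
    using w(1) unfolding es circle_walk_snoc by auto
  have p2: "is_path G us es2" "e \<notin> set es2" "ends G e = {last us, hd us}"
    using n(2) unfolding us_def circle_walk_snoc by auto
  have "set (es2 @ [e]) = set (es1 @ [e])"
    using w(3) es n(1) by (metis set_rotate)
  then have s: "set es1 = set es2"
    using p1(2) p2(2) by auto
  show ?thesis
  proof (cases "hd vs = hd us")
    case True
    then show ?thesis
      using is_path_unique[OF p1(1) p2(1) True s] rot es by simp
  next
    case False
    then have h: "hd vs = last us" "last vs = hd us"
      using p1(3) p2(3) by (auto simp: doubleton_eq_iff)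
    have "vs = rev us \<and> es1 = rev es2"
      using is_path_unique[OF p1(1) is_path_rev[OF p2(1)]] h s by (simp add: hd_rev)
    then have vs: "vs = rev us" "es1 = rev es2"
      by auto
    have "tail e = hd vs \<or> tail e = last vs" "hd vs \<noteq> last vs"
      using orient p1(3,4) False h by (auto simp: orientation_def)
    then have "wsum tail x vs es = - wsum tail x us (es2 @ [e])" for x
      using wsum_rev[OF p2(1) orient, of x] is_path_length[OF p1(1)] is_path_length[OF p2(1)] h
      unfolding es by (subst (1 2) wsum_snoc) (auto simp: vs)
    then show ?thesis
      using rot by simp
  qed
qed

lemma wsum_internally_disjoint:
  assumes d: "internally_disjoint G vs1 es1 vs2 es2" and orient: "orientation G tail"
  shows "wsum tail x (butlast vs1 @ rev (tl vs2)) (es1 @ rev es2) = wsum tail x vs1 es1 - wsum tail x vs2 es2"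
proof -
  have p: "is_path G vs1 es1" "is_path G vs2 es2"
    using d by (auto simp: internally_disjoint_def)
  have ne: "vs1 \<noteq> []" "vs2 \<noteq> []"
    using is_path_length[OF p(1)] is_path_length[OF p(2)] by auto
  have "wsum tail x (butlast vs1 @ rev (tl vs2)) (es1 @ rev es2) =
      wsum tail x (butlast vs1) es1 + wsum tail x (rev (tl vs2)) (rev es2)"
    using is_path_length[OF p(1)] by (subst wsum_append) auto
  also have "wsum tail x (butlast vs1) es1 = wsum tail x (butlast vs1 @ [last vs1]) es1"
    using is_path_length[OF p(1)] by (subst wsum_trunc) auto
  also have "wsum tail x (rev (tl vs2)) (rev es2) = wsum tail x (rev (tl vs2) @ [hd vs2]) (rev es2)"
    using is_path_length[OF p(2)] by (subst wsum_trunc) auto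
  also have "rev (tl vs2) @ [hd vs2] = rev vs2"
    using ne(2) by (cases vs2) auto
  finally show ?thesis
    using ne(1) wsum_rev[OF p(2) orient] by simp
qed

lemma gain_product_hom:
  assumes "\<And>a b. h (a + b) = h a \<otimes>\<^bsub>G\<^esub> h b" "h 0 = \<one>\<^bsub>G\<^esub>" "\<And>a. h (- a) = inv\<^bsub>G\<^esub> h a"
  shows "gain_product G tail vs (map (\<lambda>e. (h (x e), e)) es) = h (wsum tail x vs es)"
proof (induction es arbitrary: vs)
  case Nil
  then show ?case
    by (simp add: gain_product_def assms(2))
next
  case (Cons e es)
  show ?case
  proof (cases vs)
    case Nil
    then show ?thesis
      by (simp add: gain_product_def wsum_def assms(2))
  next
    case (Cons v vs')
    then show ?thesis
      using Cons.IH[of vs'] by (auto simp: gain_product_def gain_def assms)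
  qed
qed

section \<open>Labellings of three-element fibers\<close>

lemma dvd3_eq:
  fixes a b :: int
  assumes "a \<in> {-1, 0, 1}" "b \<in> {-1, 0, 1}" "c = 1 \<or> c = (-1::int)" "3 dvd r + c * a" "3 dvd r + c * b"
  shows "a = b"
proof -
  have "3 dvd (r + c * a) - (r + c * b)"
    using assms(4,5) by (rule dvd_diff)
  then have "3 dvd c * (a - b)"
    by (simp add: algebra_simps)
  then have "3 dvd a - b"
    using assms(3) by (auto simp: dvd_diff_commute)
  with assms(1,2) show ?thesis
    by auto
qed

lemma dvd3_ex:
  fixes t :: int
  assumes "c = 1 \<or> c = (-1::int)"
  obtains a where "a \<in> {-1, 0, 1}" "3 dvd t + c * a"
proof -
  have "3 dvd t \<or> 3 dvd t + 1 \<or> 3 dvd t - 1"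
    by presburger
  moreover have "3 dvd t + c * 0 \<longleftrightarrow> 3 dvd t" "3 dvd t + c * c \<longleftrightarrow> 3 dvd t + 1"
    "3 dvd t + c * (- c) \<longleftrightarrow> 3 dvd t - 1"
    using assms by auto
  moreover have "c \<in> {-1, 0, 1}" "- c \<in> {-1, 0, 1}"
    using assms by auto
  ultimately show ?thesis
    using that by blast
qed

text \<open>A Latin square of order 3 is determined by its first row and column.\<close>

lemma latin_cube:
  fixes B :: "int \<Rightarrow> int \<Rightarrow> int \<Rightarrow> bool" and r :: int
  defines "T \<equiv> {-1, 0, 1}"
  assumes c: "ca = 1 \<or> ca = -1" "cb = 1 \<or> cb = -1" "cd = 1 \<or> cd = -1"
    and ex: "\<And>b d. b \<in> T \<Longrightarrow> d \<in> T \<Longrightarrow> \<exists>a\<in>T. B a b d"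
    and u2: "\<And>a b b' d. \<lbrakk>a \<in> T; b \<in> T; b' \<in> T; d \<in> T; B a b d; B a b' d\<rbrakk> \<Longrightarrow> b = b'"
    and u3: "\<And>a b d d'. \<lbrakk>a \<in> T; b \<in> T; d \<in> T; d' \<in> T; B a b d; B a b d'\<rbrakk> \<Longrightarrow> d = d'"
    and base: "\<And>a b d. \<lbrakk>a \<in> T; b \<in> T; d \<in> T; b = 0 \<or> d = 0\<rbrakk> \<Longrightarrow>
      B a b d \<longleftrightarrow> 3 dvd r + ca * a + cb * b + cd * d"
    and abd: "a \<in> T" "b \<in> T" "d \<in> T"
  shows "B a b d \<longleftrightarrow> 3 dvd r + ca * a + cb * b + cd * d"
proof -
  have 0: "0 \<in> T"
    by (simp add: T_def)
  \<comment> \<open>For given \<open>b\<close> and \<open>d\<close> some \<open>a\<close> satisfies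
    \<open>B\<close>, whereas the congruence has at most one solution \<open>a\<close> in
    \<open>T\<close>; one implication therefore yields the equivalence.\<close>
  have iff: "B a b d \<longleftrightarrow> 3 dvd r + ca * a + cb * b + cd * d"
    if imp: "\<And>a. a \<in> T \<Longrightarrow> B a b d \<Longrightarrow> 3 dvd r + ca * a + cb * b + cd * d"
      and T: "a \<in> T" "b \<in> T" "d \<in> T" for a b d
  proof
    assume *: "3 dvd r + ca * a + cb * b + cd * d"
    obtain a' where a': "a' \<in> T" "B a' b d"
      using ex[OF T(2,3)] by blast
    have "3 dvd (r + cb * b + cd * d) + ca * a" "3 dvd (r + cb * b + cd * d) + ca * a'"
      using * imp[OF a'] by (simp_all add: algebra_simps)
    then have "a = a'"
      using dvd3_eq[of a a' ca] T(1) a'(1) c(1) by (auto simp: T_def)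
    then show "B a b d"
      using a'(2) by simp
  qed (use imp T in blast)
  \<comment> \<open>If the contributions of \<open>b\<close> and \<open>d\<close> cancel, replacing
    either one by 0 shifts the sum by 1, in opposite directions. Both shifted residues are excluded
    by uniqueness, which leaves 0.\<close>
  have opp: "B a b d \<longleftrightarrow> 3 dvd r + ca * a + cb * b + cd * d"
    if T: "a \<in> T" "b \<in> T" "d \<in> T" and o: "b \<noteq> 0" "d \<noteq> 0" "cb * b = - (cd * d)" for a b d
  proof (rule iff[OF _ T])
    fix a assume a: "a \<in> T" "B a b d"
    have "\<not> B a 0 d" "\<not> B a b 0"
      using u2[OF a(1) T(2) 0 T(3) a(2)] u3[OF a(1) T(2,3) 0 a(2)] o by auto
    then have "\<not> 3 dvd r + ca * a + cd * d" "\<not> 3 dvd r + ca * a - cd * d"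
      using base[OF a(1) 0 T(3)] base[OF a(1) T(2) 0] o(3) by auto
    moreover have "cd * d = 1 \<or> cd * d = -1"
      using T(3) o(2) c(3) by (auto simp: T_def)
    ultimately have "3 dvd r + ca * a"
      by presburger
    then show "3 dvd r + ca * a + cb * b + cd * d"
      using o(3) by simp
  qed
  show ?thesis
  proof (cases "b = 0 \<or> d = 0 \<or> cb * b = - (cd * d)")
    case True
    then show ?thesis
      using base[OF abd] opp[OF abd] by blast
  next
    case False
    then have o: "b \<noteq> 0" "d \<noteq> 0" and s: "cb * b = cd * d" "cd * d = 1 \<or> cd * d = -1"
      using abd c by (auto simp: T_def)
    \<comment> \<open>If the contributions are equal, \<open>- b\<close> falls under the cancelling
      case. The alternatives 0 and \<open>- b\<close> exclude two residues of the sum without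
      \<open>b\<close> and \<open>d\<close>, leaving the one required.\<close>
    have b: "- b \<in> T" "- b \<noteq> 0" "- b \<noteq> b" "cb * (- b) = - (cd * d)"
      using abd(2) o(1) s(1) by (auto simp: T_def)
    show ?thesis
    proof (rule iff[OF _ abd])
      fix a assume a: "a \<in> T" "B a b d"
      have "\<not> B a 0 d" "\<not> B a (- b) d"
        using u2[OF a(1) abd(2) 0 abd(3) a(2)] u2[OF a(1) abd(2) b(1) abd(3) a(2)] o b by auto
      then have "\<not> 3 dvd r + ca * a + cd * d" "\<not> 3 dvd r + ca * a"
        using base[OF a(1) 0 abd(3)] opp[OF a(1) b(1) abd(3) b(2) o(2) b(4)] b(4) by auto
      then show "3 dvd r + ca * a + cb * b + cd * d"
        using s by presburger
    qed
  qed
qed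

text \<open>The relation is the graph of a bijection of \<open>T\<close> fixing 0, hence equality or
  negation. The signs \<open>ca\<close> and \<open>cb\<close> only decide which of the two
  congruences describes which case.\<close>

lemma latin_pair:
  fixes B :: "int \<Rightarrow> int \<Rightarrow> bool"
  defines "T \<equiv> {-1, 0, 1}"
  assumes c: "ca = 1 \<or> ca = -1" "cb = 1 \<or> cb = -1"
    and ex: "\<And>b. b \<in> T \<Longrightarrow> \<exists>a\<in>T. B a b"
    and u1: "\<And>a a' b. \<lbrakk>a \<in> T; a' \<in> T; b \<in> T; B a b; B a' b\<rbrakk> \<Longrightarrow> a = a'"
    and u2: "\<And>a b b'. \<lbrakk>a \<in> T; b \<in> T; b' \<in> T; B a b; B a b'\<rbrakk> \<Longrightarrow> b = b'"
    and zero: "B 0 0"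
  shows "(\<forall>a\<in>T. \<forall>b\<in>T. B a b \<longleftrightarrow> 3 dvd ca * a + cb * b) \<or>
    (\<forall>a\<in>T. \<forall>b\<in>T. B a b \<longleftrightarrow> 3 dvd ca * a - cb * b)"
proof -
  have T: "0 \<in> T" "1 \<in> T" "-1 \<in> T"
    by (auto simp: T_def)
  have n: "\<not> B 0 1" "\<not> B 0 (-1)" "\<not> B 1 0" "\<not> B (-1) 0"
    using u1[OF _ _ T(1) zero] u2[OF T(1) _ _ zero] T by fastforce+
  have "B 1 1 \<and> B (-1) (-1) \<and> \<not> B 1 (-1) \<and> \<not> B (-1) 1 \<or>
      \<not> B 1 1 \<and> \<not> B (-1) (-1) \<and> B 1 (-1) \<and> B (-1) 1"
  proof -
    have "B 1 1 \<or> B (-1) 1" "B 1 (-1) \<or> B (-1) (-1)"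
      using ex[OF T(2)] ex[OF T(3)] n by (auto simp: T_def)
    moreover have "\<not> (B 1 1 \<and> B (-1) 1)" "\<not> (B 1 (-1) \<and> B (-1) (-1))" "\<not> (B 1 1 \<and> B 1 (-1))"
      "\<not> (B (-1) 1 \<and> B (-1) (-1))"
      using u1[OF T(2,3) T(2)] u1[OF T(2,3) T(3)] u2[OF T(2) T(2,3)] u2[OF T(3) T(2,3)] by auto
    ultimately show ?thesis
      by blast
  qed
  then show ?thesis
    using n zero c by (auto simp: T_def)
qed

section \<open>Equations modulo 3 for the balanced lifts of a circle\<close>

locale based_expansion = expansion \<Delta> \<Omega> p
  for \<Delta> :: "('v, 'e) graph" and \<Omega> :: "('v, 'f) biased_graph" and p :: "'f \<Rightarrow> 'e" +
  fixes tail :: "'e \<Rightarrow> 'v" and s :: "'e \<Rightarrow> 'f"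
  assumes orient: "orientation \<Delta> tail"
    and lift_s: "lift s"
    and bal_s: "is_circle \<Delta> C \<Longrightarrow> bal s C"
begin

text \<open>The symmetric residues \<open>-1, 0, 1\<close> are used so that negating the labels of a
  fiber permutes them and keeps \<open>s\<close> at 0.\<close>

definition labelling :: "('f \<Rightarrow> int) \<Rightarrow> bool" where
  "labelling lab \<longleftrightarrow>
    (\<forall>e\<in>edges \<Delta>. bij_betw lab (fiber \<Omega> p e) {-1, 0, 1} \<and> lab (s e) = 0)"

text \<open>On \<open>C\<close> such coefficients are determined up to a common sign, and off
  \<open>C\<close> they do not enter the sum. Divisibility by 3 is therefore independent of
  \<open>c\<close>, and no walk has to be selected for each circle.\<close>

definition circle_sign :: "'e set \<Rightarrow> ('e \<Rightarrow> int) \<Rightarrow> bool" where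
  "circle_sign C c \<longleftrightarrow> (\<forall>e. c e = 1 \<or> c e = -1) \<and>
    (\<exists>vs es. circle_walk \<Delta> vs es \<and> set es = C \<and> (\<forall>x. wsum tail x vs es = (\<Sum>e\<in>C. c e * x e)))"

definition good :: "('f \<Rightarrow> int) \<Rightarrow> 'e set \<Rightarrow> bool" where
  "good lab C \<longleftrightarrow> (\<forall>c \<sigma>. circle_sign C c \<longrightarrow> lift \<sigma> \<longrightarrow>
    (bal \<sigma> C \<longleftrightarrow> 3 dvd (\<Sum>e\<in>C. c e * lab (\<sigma> e))))"

text \<open>Lifts that leave \<open>s\<close> in no edges but \<open>e\<close> and \<open>f\<close>
  isolate the question whether the labels of these two edges carry compatible signs on
  \<open>C\<close>.\<close>

definition agree :: "('f \<Rightarrow> int) \<Rightarrow> 'e set \<Rightarrow> 'e \<Rightarrow> 'e \<Rightarrow> bool" where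
  "agree lab C e f \<longleftrightarrow> (\<forall>c \<sigma>. circle_sign C c \<longrightarrow> lift \<sigma> \<longrightarrow>
    (\<forall>g\<in>C. g \<noteq> e \<longrightarrow> g \<noteq> f \<longrightarrow> \<sigma> g = s g) \<longrightarrow> (bal \<sigma> C \<longleftrightarrow> 3 dvd (\<Sum>e\<in>C. c e * lab (\<sigma> e))))"

lemma circle_sign_ex:
  assumes "circle_walk \<Delta> vs es"
  obtains c where "circle_sign (set es) c" "\<And>x. wsum tail x vs es = (\<Sum>e\<in>set es. c e * x e)"
proof -
  have "distinct es" "length es \<le> length vs"
    using assms by (auto simp: circle_walk_def)
  from wsum_signs[OF this, of tail] obtain c where
    c: "\<And>e. c e = 1 \<or> c e = (-1::int)" "\<And>x. wsum tail x vs es = (\<Sum>e\<in>set es. c e * x e)"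
    by blast
  moreover have "circle_sign (set es) c"
    unfolding circle_sign_def using c assms by blast
  ultimately show ?thesis
    using that by blast
qed

lemma is_circle_sign_ex:
  assumes "is_circle \<Delta> C"
  obtains c where "circle_sign C c"
  using assms circle_sign_ex unfolding is_circle_def by metis

lemma circle_sign_dvd:
  assumes "circle_sign C c" "circle_walk \<Delta> vs es" "set es = C"
  shows "3 dvd (\<Sum>e\<in>C. c e * x e) \<longleftrightarrow> 3 dvd wsum tail x vs es"
proof -
  obtain vs' es' where w: "circle_walk \<Delta> vs' es'" "set es' = C"
    "\<And>x. wsum tail x vs' es' = (\<Sum>e\<in>C. c e * x e)"
    using assms(1) by (auto simp: circle_sign_def)
  have "wsum tail x vs' es' = wsum tail x vs es \<or> wsum tail x vs' es' = - wsum tail x vs es"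
    using circle_walk_wsum_unique[OF assms(2) w(1) _ orient] assms(3) w(2) by blast
  then show ?thesis
    using w(3)[of x] by auto
qed

lemma circle_sign_dvd_iff:
  assumes "circle_sign C c" "circle_sign C c'"
  shows "3 dvd (\<Sum>e\<in>C. c e * x e) \<longleftrightarrow> 3 dvd (\<Sum>e\<in>C. c' e * x e)"
proof -
  obtain vs es where "circle_walk \<Delta> vs es" "set es = C"
    using assms(1) by (auto simp: circle_sign_def)
  then show ?thesis
    using circle_sign_dvd[OF assms(1)] circle_sign_dvd[OF assms(2)] by simp
qed

lemma circle_sign_paths:
  assumes "internally_disjoint \<Delta> vs1 es1 vs2 es2" "circle_sign (set es1 \<union> set es2) c"
  shows "3 dvd (\<Sum>e\<in>set es1 \<union> set es2. c e * x e) \<longleftrightarrow> 3 dvd wsum tail x vs1 es1 - wsum tail x vs2 es2"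
  using circle_sign_dvd[OF assms(2) internally_disjoint_circle_walk[OF assms(1)]]
  by (simp add: wsum_internally_disjoint[OF assms(1) orient])

lemma circle_sign_values: "circle_sign C c \<Longrightarrow> c e = 1 \<or> c e = -1"
  by (simp add: circle_sign_def)

text \<open>One signed sum per path replaces the unspecified coefficients, so that the equations of
  circles sharing a path can be compared.\<close>

lemma good_paths_iff:
  assumes d: "internally_disjoint \<Delta> vs1 es1 vs2 es2"
  shows "good lab (set es1 \<union> set es2) \<longleftrightarrow> (\<forall>\<sigma>. lift \<sigma> \<longrightarrow>
    (bal \<sigma> (set es1 \<union> set es2) \<longleftrightarrow>
      3 dvd wsum tail (\<lambda>e. lab (\<sigma> e)) vs1 es1 - wsum tail (\<lambda>e. lab (\<sigma> e)) vs2 es2))"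
proof -
  obtain c where "circle_sign (set es1 \<union> set es2) c"
    using is_circle_sign_ex[OF internally_disjoint_is_circle[OF d]] by blast
  then show ?thesis
    unfolding good_def using circle_sign_paths[OF d, of _ "\<lambda>e. lab (_ e)"] by auto
qed

lemma labelling_value:
  assumes "labelling lab" "lift \<sigma>" "e \<in> edges \<Delta>"
  shows "lab (\<sigma> e) \<in> {-1, 0, 1}"
  using assms bij_betwE liftD unfolding labelling_def by metis

lemma labelling_eq_iff:
  assumes "labelling lab" "e \<in> edges \<Delta>" "f \<in> fiber \<Omega> p e" "f' \<in> fiber \<Omega> p e"
  shows "lab f = lab f' \<longleftrightarrow> f = f'"
  using assms unfolding labelling_def bij_betw_def inj_on_def by metis

lemma labelling_ex:
  assumes "labelling lab" "e \<in> edges \<Delta>" "a \<in> {-1, 0, 1}"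
  obtains f where "f \<in> fiber \<Omega> p e" "lab f = a"
  using assms unfolding labelling_def bij_betw_def by (metis imageE)

lemma labelling_s: "labelling lab \<Longrightarrow> e \<in> edges \<Delta> \<Longrightarrow> lab (s e) = 0"
  by (simp add: labelling_def)

text \<open>The edge \<open>f\<close> enters with coefficient 1 or -1 and its labels represent all
  residues, so \<open>f\<close> alone steers the sum to any \<open>t\<close> modulo 3.\<close>

lemma adjust_path_sum:
  assumes "labelling lab" "lift \<sigma>" "is_path \<Delta> vs es" "f \<in> set es"
  obtains b where "b \<in> fiber \<Omega> p f" "3 dvd wsum tail (\<lambda>g. lab ((\<sigma>(f := b)) g)) vs es - t"
proof -
  have "distinct es" "length es \<le> length vs" and fE: "f \<in> edges \<Delta>"
    using is_path_distinct_edges[OF assms(3)] assms(3,4) by (auto simp: is_path_def)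
  from wsum_signs[OF this(1,2), of tail] obtain c where
    c: "\<And>e. c e = 1 \<or> c e = (-1::int)" "\<And>x. wsum tail x vs es = (\<Sum>e\<in>set es. c e * x e)"
    by blast
  define r where "r = (\<Sum>g\<in>set es - {f}. c g * lab (\<sigma> g))"
  obtain a where a: "a \<in> {-1, 0, 1}" "3 dvd (r - t) + c f * a"
    using dvd3_ex[OF c(1)] by blast
  obtain b where b: "b \<in> fiber \<Omega> p f" "lab b = a"
    using labelling_ex[OF assms(1) fE a(1)] by blast
  have "wsum tail (\<lambda>g. lab ((\<sigma>(f := b)) g)) vs es = c f * a + r"
    unfolding c(2) r_def using assms(4) b(2) by (subst sum.remove[of _ f]) (auto intro: sum.cong)
  then show ?thesis
    using that[OF b(1)] a(2) by (simp add: algebra_simps)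
qed

text \<open>An edge of the first path is changed so that its sum matches that of the second path.
  This balances their circle and leaves the circle of the other two paths untouched. By the theta
  property that circle is balanced iff the first and third paths form a balanced circle, whose
  equation is known.\<close>

lemma linear_class_good:
  assumes lab: "labelling lab"
  shows "linear_class \<Delta> {C. good lab C}"
  unfolding linear_class_def
proof (intro allI impI)
  fix vs1 es1 vs2 es2 vs3 es3
  assume t: "theta_paths \<Delta> vs1 es1 vs2 es2 vs3 es3"
    and g: "set es1 \<union> set es2 \<in> {C. good lab C}" "set es1 \<union> set es3 \<in> {C. good lab C}"
  have d: "internally_disjoint \<Delta> vs1 es1 vs2 es2" "internally_disjoint \<Delta> vs1 es1 vs3 es3"
    "internally_disjoint \<Delta> vs2 es2 vs3 es3"
    using t by (auto simp: theta_paths_def)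
  have disj: "set es1 \<inter> set es2 = {}" "set es1 \<inter> set es3 = {}" and p1: "is_path \<Delta> vs1 es1"
    using d by (auto simp: internally_disjoint_def)
  let ?w = "\<lambda>\<sigma>. wsum tail (\<lambda>e. lab (\<sigma> e))"
  have "bal \<sigma> (set es2 \<union> set es3) \<longleftrightarrow> 3 dvd ?w \<sigma> vs2 es2 - ?w \<sigma> vs3 es3" if \<sigma>: "lift \<sigma>" for \<sigma>
  proof -
    have f: "hd es1 \<in> set es1"
      using internally_disjoint_nonempty[OF d(1)] by simp
    obtain b where b: "b \<in> fiber \<Omega> p (hd es1)"
      and eq: "3 dvd ?w (\<sigma>(hd es1 := b)) vs1 es1 - ?w \<sigma> vs2 es2"
      using adjust_path_sum[OF lab \<sigma> p1 f] by blast
    define \<tau> where "\<tau> = \<sigma>(hd es1 := b)"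
    have \<tau>: "lift \<tau>"
      unfolding \<tau>_def by (rule lift_upd[OF \<sigma> b])
    have same: "\<tau> e = \<sigma> e" if "e \<in> set es2 \<union> set es3" for e
      using that disj f by (auto simp: \<tau>_def)
    have w: "?w \<tau> vs2 es2 = ?w \<sigma> vs2 es2" "?w \<tau> vs3 es3 = ?w \<sigma> vs3 es3"
      by (rule wsum_cong, simp add: same)+
    have "bal \<tau> (set es1 \<union> set es2)"
      using g(1) good_paths_iff[OF d(1)] \<tau> eq w unfolding \<tau>_def by auto
    then have "bal \<tau> (set es2 \<union> set es3) \<longleftrightarrow> bal \<tau> (set es1 \<union> set es3)"
      using theta_bal_iff[OF \<tau> t] by simp
    also have "\<dots> \<longleftrightarrow> 3 dvd ?w \<tau> vs1 es1 - ?w \<tau> vs3 es3"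
      using g(2) good_paths_iff[OF d(2)] \<tau> by auto
    also have "\<dots> \<longleftrightarrow> 3 dvd ?w \<sigma> vs2 es2 - ?w \<sigma> vs3 es3"
      using eq w unfolding \<tau>_def[symmetric] by presburger
    moreover have "bal \<tau> (set es2 \<union> set es3) \<longleftrightarrow> bal \<sigma> (set es2 \<union> set es3)"
      by (rule bal_cong[OF same])
    ultimately show ?thesis
      by (simp only:)
  qed
  then show "set es2 \<union> set es3 \<in> {C. good lab C}"
    using good_paths_iff[OF d(3)] by simp
qed

text \<open>The deviation from \<open>s\<close> is moved from \<open>f'\<close> to \<open>f\<close>
  within the first path while its sum is kept modulo 3. Balance survives the move because the third
  path can stand in for the first one, their common circle being good.\<close>

lemma agree_transfer:
  assumes lab: "labelling lab"
    and t: "theta_paths \<Delta> vs1 es1 vs2 es2 vs3 es3" and g13: "good lab (set es1 \<union> set es3)"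
    and f: "f \<in> set es1" "f' \<in> set es1" and e: "e \<in> set es2"
    and ag: "agree lab (set es1 \<union> set es2) e f"
  shows "agree lab (set es1 \<union> set es2) e f'"
  unfolding agree_def
proof (intro allI impI)
  fix c \<sigma>
  let ?C = "set es1 \<union> set es2"
  assume c: "circle_sign ?C c" and \<sigma>: "lift \<sigma>"
    and supp: "\<forall>g\<in>?C. g \<noteq> e \<longrightarrow> g \<noteq> f' \<longrightarrow> \<sigma> g = s g"
  have d: "internally_disjoint \<Delta> vs1 es1 vs2 es2" "internally_disjoint \<Delta> vs1 es1 vs3 es3"
    "internally_disjoint \<Delta> vs2 es2 vs3 es3"
    using t by (auto simp: theta_paths_def)
  have disj: "set es1 \<inter> set es2 = {}" "set es1 \<inter> set es3 = {}" "set es2 \<inter> set es3 = {}"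
    and p1: "is_path \<Delta> vs1 es1" and p3: "is_path \<Delta> vs3 es3"
    using d by (auto simp: internally_disjoint_def)
  have E: "set es1 \<subseteq> edges \<Delta>"
    using p1 by (simp add: is_path_def)
  have ne: "e \<noteq> f" "e \<noteq> f'"
    using disj(1) f e by auto
  let ?w = "\<lambda>\<sigma>. wsum tail (\<lambda>e. lab (\<sigma> e))"
  \<comment> \<open>\<open>f'\<close> returns to \<open>s\<close>, and below \<open>f\<close>
    compensates for the loss in the sum of the first path.\<close>
  define \<sigma>1 where "\<sigma>1 = \<sigma>(f' := s f')"
  have \<sigma>1: "lift \<sigma>1"
    unfolding \<sigma>1_def using lift_upd[OF \<sigma>] liftD[OF lift_s] f(2) E by blast
  obtain b where b: "b \<in> fiber \<Omega> p f" "3 dvd ?w (\<sigma>1(f := b)) vs1 es1 - ?w \<sigma> vs1 es1"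
    using adjust_path_sum[OF lab \<sigma>1 p1 f(1)] by blast
  define \<sigma>2 where "\<sigma>2 = \<sigma>1(f := b)"
  have \<sigma>2: "lift \<sigma>2"
    unfolding \<sigma>2_def by (rule lift_upd[OF \<sigma>1 b(1)])
  \<comment> \<open>One edge of the third path is set so that it forms a balanced circle with the
    first; since the sum of the first path is preserved, the circle is balanced after the exchange
    too.\<close>
  define r where "r = hd es3"
  have r: "r \<in> set es3"
    using internally_disjoint_nonempty[OF d(3)] by (simp add: r_def)
  obtain b' where b': "b' \<in> fiber \<Omega> p r" "3 dvd ?w (\<sigma>(r := b')) vs3 es3 - ?w \<sigma> vs1 es1"
    using adjust_path_sum[OF lab \<sigma> p3 r] by blast
  define \<tau> \<tau>2 where "\<tau> = \<sigma>(r := b')" and "\<tau>2 = \<sigma>2(r := b')"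
  have \<tau>: "lift \<tau>" "lift \<tau>2"
    unfolding \<tau>_def \<tau>2_def by (rule lift_upd[OF \<sigma> b'(1)] lift_upd[OF \<sigma>2 b'(1)])+
  have r_notin: "r \<notin> ?C" "f \<notin> set es2 \<union> set es3" "f' \<notin> set es2 \<union> set es3"
    using disj r f by auto
  have same: "\<tau> g = \<sigma> g" "\<tau>2 g = \<sigma>2 g" if "g \<in> ?C" for g
    using that r_notin by (auto simp: \<tau>_def \<tau>2_def)
  have same3: "\<tau>2 g = \<tau> g" if "g \<in> set es2 \<union> set es3" for g
    using that r_notin by (auto simp: \<tau>_def \<tau>2_def \<sigma>2_def \<sigma>1_def)
  have w1: "?w \<tau> vs1 es1 = ?w \<sigma> vs1 es1" "?w \<tau>2 vs1 es1 = ?w \<sigma>2 vs1 es1"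
    by (rule wsum_cong, simp add: same)+
  have w3: "?w \<tau>2 vs3 es3 = ?w \<tau> vs3 es3"
    by (rule wsum_cong) (simp add: same3)
  have w2: "?w \<sigma>2 vs2 es2 = ?w \<sigma> vs2 es2"
    by (rule wsum_cong) (use r_notin in \<open>auto simp: \<sigma>2_def \<sigma>1_def\<close>)
  have "3 dvd ?w \<tau> vs1 es1 - ?w \<tau> vs3 es3"
    using b'(2) unfolding w1(1) unfolding \<tau>_def by presburger
  then have b1: "bal \<tau> (set es1 \<union> set es3)"
    using g13 good_paths_iff[OF d(2)] \<tau>(1) by auto
  have "3 dvd ?w \<tau>2 vs1 es1 - ?w \<tau>2 vs3 es3"
    using b'(2) b(2) unfolding w1(2) w3 unfolding \<tau>_def \<sigma>2_def by presburger
  then have b2: "bal \<tau>2 (set es1 \<union> set es3)"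
    using g13 good_paths_iff[OF d(2)] \<tau>(2) by auto
  note t' = theta_paths_swap[OF t]
  \<comment> \<open>The first path is traded for the third, where \<open>\<tau>\<close> and
    \<open>\<tau>2\<close> coincide, and then traded back.\<close>
  have "bal \<sigma> ?C \<longleftrightarrow> bal \<tau> ?C"
    using bal_cong[of ?C \<tau> \<sigma>] same by simp
  also have "\<dots> \<longleftrightarrow> bal \<tau> (set es3 \<union> set es2)"
    using theta_bal_iff[OF \<tau>(1) t' b1] by simp
  also have "\<dots> \<longleftrightarrow> bal \<tau>2 (set es3 \<union> set es2)"
    using bal_cong[of "set es3 \<union> set es2" \<tau>2 \<tau>] same3 by blast
  also have "\<dots> \<longleftrightarrow> bal \<tau>2 ?C"
    using theta_bal_iff[OF \<tau>(2) t' b2] by simp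
  also have "\<dots> \<longleftrightarrow> bal \<sigma>2 ?C"
    using bal_cong[of ?C \<tau>2 \<sigma>2] same by simp
  also have "\<dots> \<longleftrightarrow> 3 dvd (\<Sum>e\<in>?C. c e * lab (\<sigma>2 e))"
  proof -
    have "\<forall>g\<in>?C. g \<noteq> e \<longrightarrow> g \<noteq> f \<longrightarrow> \<sigma>2 g = s g"
      using supp by (auto simp: \<sigma>2_def \<sigma>1_def)
    then show ?thesis
      using ag c \<sigma>2 unfolding agree_def by blast
  qed
  also have "\<dots> \<longleftrightarrow> 3 dvd ?w \<sigma>2 vs1 es1 - ?w \<sigma>2 vs2 es2"
    by (rule circle_sign_paths[OF d(1) c])
  also have "\<dots> \<longleftrightarrow> 3 dvd ?w \<sigma> vs1 es1 - ?w \<sigma> vs2 es2"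
    using b(2) unfolding w2 unfolding \<sigma>2_def by presburger
  also have "\<dots> \<longleftrightarrow> 3 dvd (\<Sum>e\<in>?C. c e * lab (\<sigma> e))"
    using circle_sign_paths[OF d(1) c] by simp
  finally show "bal \<sigma> ?C \<longleftrightarrow> 3 dvd (\<Sum>e\<in>?C. c e * lab (\<sigma> e))" .
qed

section \<open>Negating the labels over a set of edges\<close>

definition flip :: "'e set \<Rightarrow> ('f \<Rightarrow> int) \<Rightarrow> 'f \<Rightarrow> int" where
  "flip F lab f = (if p f \<in> F then - lab f else lab f)"

lemma flip_lift:
  assumes "lift \<sigma>" "e \<in> edges \<Delta>"
  shows "flip F lab (\<sigma> e) = (if e \<in> F then - lab (\<sigma> e) else lab (\<sigma> e))"
  using lift_proj[OF assms] by (simp add: flip_def)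

lemma labelling_flip:
  assumes "labelling lab"
  shows "labelling (flip F lab)"
  unfolding labelling_def
proof (intro ballI conjI)
  fix e assume e: "e \<in> edges \<Delta>"
  have b: "bij_betw lab (fiber \<Omega> p e) {-1, 0, 1}"
    using assms e by (simp add: labelling_def)
  have "bij_betw uminus {-1, 0, 1::int} {-1, 0, 1}"
    by (rule bij_betwI[of _ _ _ uminus]) auto
  then have "bij_betw (\<lambda>f. - lab f) (fiber \<Omega> p e) {-1, 0, 1}"
    using bij_betw_trans[OF b] by (simp add: comp_def)
  moreover have "bij_betw (flip F lab) (fiber \<Omega> p e) {-1, 0, 1} \<longleftrightarrow>
      bij_betw (if e \<in> F then \<lambda>f. - lab f else lab) (fiber \<Omega> p e) {-1, 0, 1}"
    by (rule bij_betw_cong) (auto simp: flip_def fiber_def)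
  ultimately show "bij_betw (flip F lab) (fiber \<Omega> p e) {-1, 0, 1}"
    using b by simp
  show "flip F lab (s e) = 0"
    using labelling_s[OF assms e] by (simp add: flip_def)
qed

lemma good_flip:
  assumes "good lab C" "C \<subseteq> edges \<Delta>" "C \<subseteq> F \<or> C \<inter> F = {}"
  shows "good (flip F lab) C"
  unfolding good_def
proof (intro allI impI)
  fix c \<sigma> assume c: "circle_sign C c" and \<sigma>: "lift \<sigma>"
  have flip: "flip F lab (\<sigma> e) = (if e \<in> F then - lab (\<sigma> e) else lab (\<sigma> e))" if "e \<in> C" for e
    using flip_lift[OF \<sigma>] assms(2) that by blast
  from assms(3) have "(\<Sum>e\<in>C. c e * flip F lab (\<sigma> e)) = - (\<Sum>e\<in>C. c e * lab (\<sigma> e)) \<or>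
    (\<Sum>e\<in>C. c e * flip F lab (\<sigma> e)) = (\<Sum>e\<in>C. c e * lab (\<sigma> e))"
  proof
    assume "C \<subseteq> F"
    then have "(\<Sum>e\<in>C. c e * flip F lab (\<sigma> e)) = (\<Sum>e\<in>C. - (c e * lab (\<sigma> e)))"
      using flip by (intro sum.cong) auto
    then show ?thesis
      by (simp add: sum_negf)
  next
    assume "C \<inter> F = {}"
    then have "(\<Sum>e\<in>C. c e * flip F lab (\<sigma> e)) = (\<Sum>e\<in>C. c e * lab (\<sigma> e))"
      using flip by (intro sum.cong) auto
    then show ?thesis ..
  qed
  then have "3 dvd (\<Sum>e\<in>C. c e * flip F lab (\<sigma> e)) \<longleftrightarrow> 3 dvd (\<Sum>e\<in>C. c e * lab (\<sigma> e))"
    by (elim disjE) (simp_all only: dvd_minus_iff)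
  then show "bal \<sigma> C \<longleftrightarrow> 3 dvd (\<Sum>e\<in>C. c e * flip F lab (\<sigma> e))"
    using assms(1) c \<sigma> by (simp add: good_def)
qed

lemma pair_sum:
  assumes "labelling lab" "is_circle \<Delta> C" "e \<in> C" "f \<in> C" "e \<noteq> f"
    and "\<forall>g\<in>C. g \<noteq> e \<longrightarrow> g \<noteq> f \<longrightarrow> \<sigma> g = s g"
  shows "(\<Sum>g\<in>C. c g * lab (\<sigma> g)) = c e * lab (\<sigma> e) + c f * lab (\<sigma> f)"
proof -
  have "(\<Sum>g\<in>C - {e, f}. c g * lab (\<sigma> g)) = 0"
    using assms(6) labelling_s[OF assms(1)] is_circle_edges[OF assms(2)]
    by (intro sum.neutral) auto
  then show ?thesis
    using is_circle_finite[OF assms(2)] assms(3-5)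
    by (subst sum.subset_diff[of "{e, f}"]) auto
qed

lemma agree_flip_outside:
  assumes "labelling lab" "is_circle \<Delta> C" "e \<in> C" "f \<in> C" "e \<noteq> f" "e \<notin> F" "f \<notin> F" "agree lab C e f"
  shows "agree (flip F lab) C e f"
  unfolding agree_def
proof (intro allI impI)
  fix c \<sigma>
  assume c: "circle_sign C c" and \<sigma>: "lift \<sigma>" and supp: "\<forall>g\<in>C. g \<noteq> e \<longrightarrow> g \<noteq> f \<longrightarrow> \<sigma> g = s g"
  have "e \<in> edges \<Delta>" "f \<in> edges \<Delta>"
    using assms(3,4) is_circle_edges[OF assms(2)] by auto
  then have "(\<Sum>g\<in>C. c g * flip F lab (\<sigma> g)) = (\<Sum>g\<in>C. c g * lab (\<sigma> g))"
    using flip_lift[OF \<sigma>] assms(6,7)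
    by (simp add: pair_sum[OF assms(1-5) supp] pair_sum[OF labelling_flip[OF assms(1)] assms(2-5) supp])
  then show "bal \<sigma> C \<longleftrightarrow> 3 dvd (\<Sum>g\<in>C. c g * flip F lab (\<sigma> g))"
    using assms(8) c \<sigma> supp unfolding agree_def by metis
qed

text \<open>By \<open>latin_pair\<close> the balanced lifts that leave \<open>s\<close> only in
  \<open>e\<close> and \<open>f\<close> obey one of two congruences, which differ in the sign of the
  label of \<open>f\<close>. Negating over \<open>F\<close>, which contains \<open>f\<close> but not
  \<open>e\<close>, interchanges them.\<close>

lemma agree_or_flip:
  assumes lab: "labelling lab" and C: "is_circle \<Delta> C" "e \<in> C" "f \<in> C" "e \<noteq> f"
    and F: "e \<notin> F" "f \<in> F"
  shows "agree lab C e f \<or> agree (flip F lab) C e f"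
proof -
  let ?T = "{-1, 0, 1::int}"
  have E: "e \<in> edges \<Delta>" "f \<in> edges \<Delta>"
    using C(2,3) is_circle_edges[OF C(1)] by auto
  have "\<forall>g\<in>edges \<Delta>. \<forall>a\<in>?T. \<exists>h. h \<in> fiber \<Omega> p g \<and> lab h = a"
    using labelling_ex[OF lab] by metis
  then obtain mk where mk: "\<And>g a. g \<in> edges \<Delta> \<Longrightarrow> a \<in> ?T \<Longrightarrow> mk g a \<in> fiber \<Omega> p g \<and> lab (mk g a) = a"
    by metis
  define \<tau> where "\<tau> a b = s(e := mk e a, f := mk f b)" for a b
  have \<tau>: "lift (\<tau> a b)" if "a \<in> ?T" "b \<in> ?T" for a b
    unfolding \<tau>_def using mk E that lift_s by (intro lift_upd) auto
  have lab_\<tau>: "lab (\<tau> a b e) = a" "lab (\<tau> a b f) = b" if "a \<in> ?T" "b \<in> ?T" for a b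
    unfolding \<tau>_def using mk E that C(4) by auto
  define B where "B a b = bal (\<tau> a b) C" for a b
  \<comment> \<open>Labels identify the edges of a fiber, so balance of such a lift is a relation
    between two labels.\<close>
  have red: "bal \<sigma> C \<longleftrightarrow> B (lab (\<sigma> e)) (lab (\<sigma> f))"
    if \<sigma>: "lift \<sigma>" "\<forall>g\<in>C. g \<noteq> e \<longrightarrow> g \<noteq> f \<longrightarrow> \<sigma> g = s g" for \<sigma>
  proof -
    have v: "lab (\<sigma> e) \<in> ?T" "lab (\<sigma> f) \<in> ?T"
      using labelling_value[OF lab \<sigma>(1)] E by blast+
    have "mk e (lab (\<sigma> e)) = \<sigma> e" "mk f (lab (\<sigma> f)) = \<sigma> f"
      using labelling_eq_iff[OF lab] mk[OF E(1) v(1)] mk[OF E(2) v(2)] liftD[OF \<sigma>(1)] E by metis+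
    then show ?thesis
      unfolding B_def by (intro bal_cong) (use \<sigma>(2) in \<open>auto simp: \<tau>_def\<close>)
  qed
  obtain c0 where c0: "circle_sign C c0"
    using is_circle_sign_ex[OF C(1)] by blast
  note cv = circle_sign_values[OF c0, of e] circle_sign_values[OF c0, of f]
  have "(\<forall>a\<in>?T. \<forall>b\<in>?T. B a b \<longleftrightarrow> 3 dvd c0 e * a + c0 f * b) \<or>
    (\<forall>a\<in>?T. \<forall>b\<in>?T. B a b \<longleftrightarrow> 3 dvd c0 e * a - c0 f * b)"
  proof (rule latin_pair[OF cv])
    fix b assume b: "b \<in> ?T"
    obtain h where h: "h \<in> fiber \<Omega> p e" "bal ((\<tau> 0 b)(e := h)) C"
      using circle_lifting[OF C(1,2) \<tau>[of 0 b]] b by auto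
    have "lift ((\<tau> 0 b)(e := h))"
      using lift_upd[OF \<tau>[of 0 b] h(1)] b by simp
    moreover have "\<forall>g\<in>C. g \<noteq> e \<longrightarrow> g \<noteq> f \<longrightarrow> ((\<tau> 0 b)(e := h)) g = s g"
      by (simp add: \<tau>_def)
    ultimately have "B (lab (((\<tau> 0 b)(e := h)) e)) (lab (((\<tau> 0 b)(e := h)) f))"
      using red h(2) by blast
    moreover have "lab (((\<tau> 0 b)(e := h)) f) = b"
      using lab_\<tau>(2)[of 0 b] b C(4) by simp
    moreover have "lab (((\<tau> 0 b)(e := h)) e) \<in> ?T"
      using labelling_value[OF lab \<open>lift ((\<tau> 0 b)(e := h))\<close> E(1)] .
    ultimately show "\<exists>a\<in>?T. B a b"
      by metis
  next
    fix a a' b assume *: "a \<in> ?T" "a' \<in> ?T" "b \<in> ?T" "B a b" "B a' b"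
    have "\<tau> a b e = \<tau> a' b e"
      by (rule bal_unique[OF C(1,2) \<tau>[OF *(1,3)] \<tau>[OF *(2,3)]]) (use * in \<open>auto simp: B_def \<tau>_def\<close>)
    then show "a = a'"
      using lab_\<tau>(1)[OF *(1,3)] lab_\<tau>(1)[OF *(2,3)] by metis
  next
    fix a b b' assume *: "a \<in> ?T" "b \<in> ?T" "b' \<in> ?T" "B a b" "B a b'"
    have "\<tau> a b f = \<tau> a b' f"
      by (rule bal_unique[OF C(1,3) \<tau>[OF *(1,2)] \<tau>[OF *(1,3)]]) (use * in \<open>auto simp: B_def \<tau>_def\<close>)
    then show "b = b'"
      using lab_\<tau>(2)[OF *(1,2)] lab_\<tau>(2)[OF *(1,3)] by metis
  next
    have "bal s C \<longleftrightarrow> B (lab (s e)) (lab (s f))"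
      by (rule red[OF lift_s]) simp
    then show "B 0 0"
      using bal_s[OF C(1)] labelling_s[OF lab] E by simp
  qed
  then show ?thesis
  proof
    assume B: "\<forall>a\<in>?T. \<forall>b\<in>?T. B a b \<longleftrightarrow> 3 dvd c0 e * a + c0 f * b"
    have "agree lab C e f"
      unfolding agree_def
    proof (intro allI impI)
      fix c \<sigma>
      assume c: "circle_sign C c" and \<sigma>: "lift \<sigma>" and supp: "\<forall>g\<in>C. g \<noteq> e \<longrightarrow> g \<noteq> f \<longrightarrow> \<sigma> g = s g"
      have "bal \<sigma> C \<longleftrightarrow> 3 dvd c0 e * lab (\<sigma> e) + c0 f * lab (\<sigma> f)"
        using red[OF \<sigma> supp] B labelling_value[OF lab \<sigma>] E by blast
      also have "\<dots> \<longleftrightarrow> 3 dvd (\<Sum>g\<in>C. c0 g * lab (\<sigma> g))"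
        by (simp add: pair_sum[OF lab C supp])
      also have "\<dots> \<longleftrightarrow> 3 dvd (\<Sum>g\<in>C. c g * lab (\<sigma> g))"
        by (rule circle_sign_dvd_iff[OF c0 c])
      finally show "bal \<sigma> C \<longleftrightarrow> 3 dvd (\<Sum>g\<in>C. c g * lab (\<sigma> g))" .
    qed
    then show ?thesis ..
  next
    assume B: "\<forall>a\<in>?T. \<forall>b\<in>?T. B a b \<longleftrightarrow> 3 dvd c0 e * a - c0 f * b"
    have "agree (flip F lab) C e f"
      unfolding agree_def
    proof (intro allI impI)
      fix c \<sigma>
      assume c: "circle_sign C c" and \<sigma>: "lift \<sigma>" and supp: "\<forall>g\<in>C. g \<noteq> e \<longrightarrow> g \<noteq> f \<longrightarrow> \<sigma> g = s g"
      have "bal \<sigma> C \<longleftrightarrow> 3 dvd c0 e * lab (\<sigma> e) - c0 f * lab (\<sigma> f)"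
        using red[OF \<sigma> supp] B labelling_value[OF lab \<sigma>] E by blast
      also have "\<dots> \<longleftrightarrow> 3 dvd (\<Sum>g\<in>C. c0 g * flip F lab (\<sigma> g))"
        using F by (simp add: pair_sum[OF labelling_flip[OF lab] C supp] flip_lift[OF \<sigma>] E)
      also have "\<dots> \<longleftrightarrow> 3 dvd (\<Sum>g\<in>C. c g * flip F lab (\<sigma> g))"
        by (rule circle_sign_dvd_iff[OF c0 c])
      finally show "bal \<sigma> C \<longleftrightarrow> 3 dvd (\<Sum>g\<in>C. c g * flip F lab (\<sigma> g))" .
    qed
    then show ?thesis ..
  qed
qed

end

section \<open>Extending labellings\<close>

text \<open>A circle remains connected when the node \<open>y\<close> is removed, so a property that
  spreads across all other nodes holds everywhere on it or nowhere.\<close>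

lemma circle_all_or_none:
  assumes c: "circle_walk G vs es"
    and step: "\<And>g g' x. \<lbrakk>g \<in> set es; g' \<in> set es; x \<in> ends G g; x \<in> ends G g'; x \<noteq> y; P g\<rbrakk> \<Longrightarrow> P g'"
  shows "(\<forall>g\<in>set es. P g) \<or> (\<forall>g\<in>set es. \<not> P g)"
proof -
  \<comment> \<open>The walk starts at \<open>y\<close> if it contains \<open>y\<close> at all;
    consecutive entries of the edge list then meet at other nodes.\<close>
  obtain n where n: "hd (rotate n vs) = y \<or> y \<notin> set vs"
    using rotate_to_hd[of y vs] by blast
  define us ds where "us = rotate n vs" and "ds = rotate n es"
  have c': "circle_walk G us ds"
    using circle_walk_rotate[OF c] by (simp add: us_def ds_def)
  have s: "set us = set vs" "set ds = set es"
    by (simp_all add: us_def ds_def)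
  have "(\<forall>g\<in>set ds. P g) \<or> (\<forall>g\<in>set ds. \<not> P g)"
  proof (rule list_all_or_none)
    fix xs a b ys assume ds: "ds = xs @ a # b # ys"
    let ?k = "length xs"
    have len: "length us = length ds" "Suc ?k < length ds"
      using c' ds by (auto simp: circle_walk_def)
    have ends: "ends G (ds ! i) = {us ! i, us ! (Suc i mod length ds)}" if "i < length ds" for i
      using c' that by (auto simp: circle_walk_def)
    have "us ! Suc ?k \<in> ends G a" "us ! Suc ?k \<in> ends G b"
      using ends[of ?k] ends[of "Suc ?k"] len(2) by (auto simp: ds nth_append)
    moreover have "us ! Suc ?k \<noteq> y"
    proof (cases "y \<in> set vs")
      case True
      then have "y = us ! 0"
        using n s(1) by (metis hd_conv_nth empty_iff empty_set us_def)
      moreover have "distinct us"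
        using c' by (simp add: circle_walk_def)
      moreover have "0 < length us" "Suc ?k < length us"
        using len by auto
      ultimately show ?thesis
        using nth_eq_iff_index_eq[of us "Suc ?k" 0] by simp
    next
      case False
      then show ?thesis
        using len s(1) nth_mem by metis
    qed
    moreover have "a \<in> set es" "b \<in> set es"
      using s(2) ds by auto
    ultimately show "P a \<longleftrightarrow> P b"
      using step by metis
  qed
  then show ?thesis
    by (simp add: s)
qed

text \<open>
  A shortest path in \<open>A\<close> that joins the parts of the path before and after its node \<open>vs ! k\<close>, and
  avoids that node, is a chord of the circle.
\<close>

lemma bridge_theta:
  assumes c: "circle_walk G vs (es @ [e])" and k: "k < length es" "a < k"
    and path: "is_path G us ds" "set ds \<subseteq> A" "vs ! k \<notin> set us" "hd us = vs ! Suc k" "last us = vs ! a"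
    and e: "e \<notin> A"
  obtains vs1 es1 vs2 es2 vs3 es3 where "theta_paths G vs1 es1 vs2 es2 vs3 es3"
    "set es1 \<union> set es2 = insert e (set es)" "e \<in> set es2" "es ! k \<in> set es1" "es ! (k - 1) \<in> set es1"
    "set es1 \<subseteq> set es" "set es3 \<subseteq> A"
proof -
  \<comment> \<open>Candidates run from a node after position \<open>k\<close> to a node before it;
    the positions are left open so that a shortest one can be cut down to a chord.\<close>
  define P where "P q \<longleftrightarrow> is_path G (fst q) (snd q) \<and> set (snd q) \<subseteq> A \<and> vs ! k \<notin> set (fst q) \<and>
    (\<exists>b. k < b \<and> b \<le> length es \<and> hd (fst q) = vs ! b) \<and> (\<exists>a<k. last (fst q) = vs ! a)" for q
  have "k < Suc k \<and> Suc k \<le> length es \<and> hd us = vs ! Suc k"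
    using path(4) k(1) by simp
  then have "P (us, ds)"
    unfolding P_def using path k(2) by auto
  from ex_has_least_nat[of P, OF this, of "\<lambda>q. length (fst q)"]
  obtain q where "P q" and "\<forall>q'. P q' \<longrightarrow> length (fst q) \<le> length (fst q')"
    by blast
  then obtain us ds where P: "P (us, ds)"
    and min: "\<And>us' ds'. P (us', ds') \<Longrightarrow> length us \<le> length us'"
    by (metis prod.collapse fst_conv)
  from P obtain a b where u: "is_path G us ds" "set ds \<subseteq> A" "vs ! k \<notin> set us"
    and b: "k < b" "b \<le> length es" "hd us = vs ! b" and a: "a < k" "last us = vs ! a"
    by (auto simp: P_def)
  have p: "is_path G vs es" and e': "e \<notin> set es"
    using c by (auto simp: circle_walk_snoc)
  have len: "length vs = Suc (length es)" and dv: "distinct vs"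
    using p by (auto simp: is_path_def)
  have ab: "a < b" "b < length vs" "vs ! a \<noteq> vs ! b"
    using a b len dv by (auto simp: nth_eq_iff_index_eq)
  have une: "us \<noteq> []"
    using u(1) by (auto simp: is_path_def)
  \<comment> \<open>An inner node on the circle lies before or after position \<open>k\<close>; the
    piece up to it or the piece from it on would be a shorter candidate.\<close>
  have inner: "z = hd us \<or> z = last us" if z: "z \<in> set us" "z \<in> set vs" for z
  proof (rule ccontr)
    assume n: "\<not> ?thesis"
    obtain as bs where us: "us = as @ z # bs"
      using z(1) by (auto simp: in_set_conv_decomp)
    have ne: "as \<noteq> []" "bs \<noteq> []"
      using n us by auto
    obtain m where m: "m < length vs" "z = vs ! m"
      using z(2) by (auto simp: in_set_conv_nth)
    have ds: "ds = take (length as) ds @ drop (length as) ds" "length (take (length as) ds) = length as"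
      using is_path_length[OF u(1)] us by auto
    have pp: "is_path G (as @ [z]) (take (length as) ds)" "is_path G (z # bs) (drop (length as) ds)"
      using is_path_appendD[of G as z bs "take (length as) ds" "drop (length as) ds"] u(1) us ds by auto
    have sub: "set (take (length as) ds) \<subseteq> A" "set (drop (length as) ds) \<subseteq> A"
      using u(2) set_take_subset set_drop_subset by fast+
    have "m \<noteq> k"
      using u(3) z(1) m(2) by auto
    then consider "m < k" | "k < m" "m \<le> length es"
      using m(1) len by linarith
    then show False
    proof cases
      case 1
      have "hd (as @ [z]) = vs ! b"
        using b(3) ne(1) us by (simp add: hd_append)
      then have "P (as @ [z], take (length as) ds)"
        unfolding P_def using pp(1) sub(1) u(3) us b(1,2) 1 m(2) by auto
      from min[OF this] show False
        using ne(2) us by (cases bs) auto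
    next
      case 2
      have "last (z # bs) = vs ! a"
        using a(2) us by simp
      then have "P (z # bs, drop (length as) ds)"
        unfolding P_def using pp(2) sub(2) u(3) us a(1) 2 m(2) by auto
      from min[OF this] show False
        using ne(1) us by (cases as) auto
    qed
  qed
  define ps as' bs where "ps = take a vs" and "as' = drop (Suc a) (take b vs)" and "bs = drop (Suc b) vs"
  define e0 gs hs where "e0 = take a es" and "gs = drop a (take b es)" and "hs = drop b es"
  have vs: "vs = ps @ vs ! a # as' @ vs ! b # bs"
  proof -
    have "take b vs = ps @ vs ! a # as'"
      using id_take_nth_drop[of a "take b vs"] ab by (simp add: ps_def as'_def min_def)
    then show ?thesis
      using id_take_nth_drop[of b vs] ab by (simp add: bs_def)
  qed
  have es: "es = e0 @ gs @ hs"
  proof -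
    have "take b es = e0 @ gs"
      using append_take_drop_id[of a "take b es"] ab(1) by (simp add: e0_def gs_def min_def)
    then show ?thesis
      using append_take_drop_id[of b es] by (simp add: hs_def)
  qed
  have l: "length e0 = length ps" "length gs = Suc (length as')"
    using ab b(2) len by (auto simp: e0_def gs_def ps_def as'_def)
  obtain cs where cs: "rev us = vs ! a # cs @ [vs ! b]"
  proof -
    obtain z zs where z: "rev us = z # zs"
      using une by (cases "rev us") auto
    then have "z = vs ! a"
      using a(2) une by (metis hd_rev list.sel(1))
    moreover have "last (rev us) = vs ! b"
      using b(3) une by (simp add: last_rev)
    ultimately have "zs \<noteq> []" "last zs = vs ! b"
      using z ab(3) by (auto split: if_splits)
    then show ?thesis
      using that[of "butlast zs"] z \<open>z = vs ! a\<close> by (metis append_butlast_last_id)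
  qed
  have cp: "is_path G (vs ! a # cs @ [vs ! b]) (rev ds)"
    using is_path_rev[OF u(1)] by (simp add: cs)
  have cs_set: "insert (vs ! a) (insert (vs ! b) (set cs)) = set us"
    using arg_cong[OF cs, of set] by auto
  have cs_disj: "set cs \<inter> set (ps @ vs ! a # as' @ vs ! b # bs) = {}"
  proof -
    have "z \<notin> set vs" if "z \<in> set cs" for z
      using inner[of z] that cs_set cp a(2) b(3) by (auto simp: is_path_def)
    then show ?thesis
      unfolding vs[symmetric] by auto
  qed
  \<comment> \<open>An edge shared with \<open>es\<close> would join \<open>vs ! a\<close> and
    \<open>vs ! b\<close> as neighbours on the path, but \<open>a < k < b\<close> separates
    them.\<close>
  have ds_disj: "set (rev ds) \<inter> insert e (set (e0 @ gs @ hs)) = {}"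
  proof -
    have "h \<notin> set es" if "h \<in> set ds" for h
    proof
      assume "h \<in> set es"
      then obtain i where i: "i < length es" "h = es ! i"
        by (auto simp: in_set_conv_nth)
      then have h: "ends G h = {vs ! i, vs ! Suc i}"
        using p by (simp add: is_path_def)
      moreover have "ends G h \<subseteq> set us"
        using is_path_ends[OF u(1) that] .
      ultimately have "{vs ! i, vs ! Suc i} \<subseteq> {vs ! a, vs ! b}"
        using inner[of "vs ! i"] inner[of "vs ! Suc i"] a(2) b(3) i(1) len by auto
      then have "(i = a \<or> i = b) \<and> (Suc i = a \<or> Suc i = b)"
        using dv i(1) ab len by (auto simp: nth_eq_iff_index_eq)
      then show False
        using a(1) b(1) ab(1) by linarith
    qed
    then show ?thesis
      using u(2) e unfolding es[symmetric] by auto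
  qed
  have "circle_walk G (ps @ vs ! a # as' @ vs ! b # bs) ((e0 @ gs @ hs) @ [e])"
    using c unfolding vs[symmetric] es[symmetric] .
  from chord_theta[OF this l cp cs_disj ds_disj]
  have t: "theta_paths G (vs ! a # as' @ [vs ! b]) gs (rev (vs ! b # bs @ ps @ [vs ! a])) (rev (hs @ e # e0))
    (vs ! a # cs @ [vs ! b]) (rev ds)" .
  have mem: "es ! i \<in> set gs" if "a \<le> i" "i < b" for i
  proof -
    have "gs ! (i - a) = es ! i" "i - a < length gs"
      using that b(2) by (auto simp: gs_def)
    then show ?thesis
      by (metis nth_mem)
  qed
  show ?thesis
  proof (rule that[OF t])
    show "set gs \<union> set (rev (hs @ e # e0)) = insert e (set es)"
      by (subst es) auto
    show "set gs \<subseteq> set es"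
      by (subst es) auto
  qed (use mem a b u(2) in auto)
qed

context based_expansion
begin

lemma labelling_inverse:
  assumes "labelling lab"
  obtains mk where "\<And>g a. g \<in> edges \<Delta> \<Longrightarrow> a \<in> {-1, 0, 1} \<Longrightarrow> mk g a \<in> fiber \<Omega> p g"
    "\<And>g a. g \<in> edges \<Delta> \<Longrightarrow> a \<in> {-1, 0, 1} \<Longrightarrow> lab (mk g a) = a"
    "\<And>g f. g \<in> edges \<Delta> \<Longrightarrow> f \<in> fiber \<Omega> p g \<Longrightarrow> mk g (lab f) = f"
proof (rule that[of "\<lambda>g. inv_into (fiber \<Omega> p g) lab"])
  fix g assume "g \<in> edges \<Delta>"
  then have b: "bij_betw lab (fiber \<Omega> p g) {-1, 0, 1}"
    using assms by (simp add: labelling_def)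
  show "inv_into (fiber \<Omega> p g) lab a \<in> fiber \<Omega> p g" if "a \<in> {-1, 0, 1}" for a
    using bij_betwE[OF bij_betw_inv_into[OF b]] that by blast
  show "lab (inv_into (fiber \<Omega> p g) lab a) = a" if "a \<in> {-1, 0, 1}" for a
    using bij_betw_inv_into_right[OF b that] .
  show "inv_into (fiber \<Omega> p g) lab (lab f) = f" if "f \<in> fiber \<Omega> p g" for f
    using bij_betw_inv_into_left[OF b that] .
qed

lemma good_loop:
  assumes lab: "labelling lab" and C: "is_circle \<Delta> {e}"
  shows "good lab {e}"
  unfolding good_def
proof (intro allI impI)
  fix c \<sigma> assume c: "circle_sign {e} c" and \<sigma>: "lift \<sigma>"
  have E: "e \<in> edges \<Delta>"
    using is_circle_edges[OF C] by simp
  have "bal \<sigma> {e} \<longleftrightarrow> \<sigma> e = s e"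
    using bal_unique[OF C _ \<sigma> lift_s] bal_s[OF C] by auto
  also have "\<dots> \<longleftrightarrow> lab (\<sigma> e) = 0"
    using labelling_eq_iff[OF lab E liftD[OF \<sigma> E] liftD[OF lift_s E]] labelling_s[OF lab E] by simp
  also have "\<dots> \<longleftrightarrow> 3 dvd (\<Sum>e\<in>{e}. c e * lab (\<sigma> e))"
    using circle_sign_values[OF c, of e] labelling_value[OF lab \<sigma> E] by auto
  finally show "bal \<sigma> {e} \<longleftrightarrow> 3 dvd (\<Sum>e\<in>{e}. c e * lab (\<sigma> e))" .
qed

text \<open>Induction on the number of edges other than \<open>e\<close> in which the lift leaves
  \<open>s\<close>. If there are two, \<open>i\<close> and \<open>j\<close>, the labels of
  \<open>e\<close>, \<open>i\<close>, \<open>j\<close> are varied: the equation holds by induction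
  when the label of \<open>i\<close> or \<open>j\<close> is 0, and \<open>latin_cube\<close> fills
  in the rest. A loop is treated apart, as it offers no second edge.\<close>

lemma agree_imp_good:
  assumes lab: "labelling lab" and C: "is_circle \<Delta> C" "e \<in> C"
    and ag: "\<And>f. f \<in> C \<Longrightarrow> f \<noteq> e \<Longrightarrow> agree lab C e f"
  shows "good lab C"
proof (cases "C = {e}")
  case True
  then show ?thesis
    using good_loop[OF lab] C by simp
next
  case False
  let ?T = "{-1, 0, 1::int}"
  have E: "g \<in> edges \<Delta>" if "g \<in> C" for g
    using that is_circle_edges[OF C(1)] by auto
  have fin: "finite C"
    by (rule is_circle_finite[OF C(1)])
  obtain mk where mk: "\<And>g a. g \<in> edges \<Delta> \<Longrightarrow> a \<in> ?T \<Longrightarrow> mk g a \<in> fiber \<Omega> p g"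
    "\<And>g a. g \<in> edges \<Delta> \<Longrightarrow> a \<in> ?T \<Longrightarrow> lab (mk g a) = a"
    "\<And>g f. g \<in> edges \<Delta> \<Longrightarrow> f \<in> fiber \<Omega> p g \<Longrightarrow> mk g (lab f) = f"
    using labelling_inverse[OF lab] by metis
  have mk0: "mk g 0 = s g" if "g \<in> C" for g
    using mk(3)[OF E[OF that] liftD[OF lift_s E[OF that]]] labelling_s[OF lab E[OF that]] by simp
  define supp where "supp \<sigma> = {g \<in> C - {e}. \<sigma> g \<noteq> s g}" for \<sigma>
  show ?thesis
    unfolding good_def
  proof (intro allI impI)
    fix c \<sigma> assume c: "circle_sign C c" and "lift \<sigma>"
    then show "bal \<sigma> C \<longleftrightarrow> 3 dvd (\<Sum>g\<in>C. c g * lab (\<sigma> g))"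
    proof (induction "card (supp \<sigma>)" arbitrary: \<sigma> rule: less_induct)
      case less
      note \<sigma> = \<open>lift \<sigma>\<close>
      \<comment> \<open>The base case allows a deviation at \<open>e\<close> and at one further
        edge, which is what \<open>agree\<close> covers.\<close>
      show ?case
      proof (cases "\<exists>f\<in>C - {e}. supp \<sigma> \<subseteq> {f}")
        case True
        then obtain f where "f \<in> C" "f \<noteq> e" "supp \<sigma> \<subseteq> {f}"
          by auto
        moreover have "\<forall>g\<in>C. g \<noteq> e \<longrightarrow> g \<noteq> f \<longrightarrow> \<sigma> g = s g"
          using \<open>supp \<sigma> \<subseteq> {f}\<close> by (auto simp: supp_def)
        ultimately show ?thesis
          using ag c \<sigma> unfolding agree_def by blast
      next
        case no: False
        have "C - {e} \<noteq> {}"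
          using False C(2) by auto
        then obtain i where i: "i \<in> supp \<sigma>"
          using no by blast
        then have "i \<in> C - {e}"
          by (auto simp: supp_def)
        then obtain j where j: "j \<in> supp \<sigma>" "j \<noteq> i"
          using no by blast
        have ij: "i \<in> C" "j \<in> C" "i \<noteq> e" "j \<noteq> e" "i \<noteq> j"
          using i j by (auto simp: supp_def)
        note Ee = E[OF C(2)] and Ei = E[OF ij(1)] and Ej = E[OF ij(2)]
        define \<tau> where "\<tau> a b d = \<sigma>(e := mk e a, i := mk i b, j := mk j d)" for a b d
        define r where "r = (\<Sum>g\<in>C - {e, i, j}. c g * lab (\<sigma> g))"
        have \<tau>: "lift (\<tau> a b d)" if "a \<in> ?T" "b \<in> ?T" "d \<in> ?T" for a b d
          unfolding \<tau>_def using mk(1) that Ee Ei Ej \<sigma> by (intro lift_upd) auto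
        have lab\<tau>: "lab (\<tau> a b d e) = a" "lab (\<tau> a b d i) = b" "lab (\<tau> a b d j) = d"
          if "a \<in> ?T" "b \<in> ?T" "d \<in> ?T" for a b d
          unfolding \<tau>_def using mk(2) that Ee Ei Ej ij by auto
        have sum: "(\<Sum>g\<in>C. c g * lab (\<tau> a b d g)) = r + c e * a + c i * b + c j * d"
          if "a \<in> ?T" "b \<in> ?T" "d \<in> ?T" for a b d
        proof -
          have "(\<Sum>g\<in>C. c g * lab (\<tau> a b d g)) =
              (\<Sum>g\<in>C - {e, i, j}. c g * lab (\<tau> a b d g)) + (\<Sum>g\<in>{e, i, j}. c g * lab (\<tau> a b d g))"
            using fin C(2) ij by (intro sum.subset_diff) auto
          also have "(\<Sum>g\<in>C - {e, i, j}. c g * lab (\<tau> a b d g)) = r"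
            unfolding r_def by (rule sum.cong) (auto simp: \<tau>_def)
          also have "(\<Sum>g\<in>{e, i, j}. c g * lab (\<tau> a b d g)) = c e * a + c i * b + c j * d"
            using ij lab\<tau>[OF that] by simp
          finally show ?thesis
            by simp
        qed
        define B where "B a b d = bal (\<tau> a b d) C" for a b d
        have cube: "B a b d \<longleftrightarrow> 3 dvd r + c e * a + c i * b + c j * d"
          if T: "a \<in> ?T" "b \<in> ?T" "d \<in> ?T" for a b d
        proof (rule latin_cube[where B = B, OF circle_sign_values[OF c] circle_sign_values[OF c]
              circle_sign_values[OF c] _ _ _ _ T])
          fix b d assume bd: "b \<in> ?T" "d \<in> ?T"
          obtain h where h: "h \<in> fiber \<Omega> p e" "bal ((\<tau> 0 b d)(e := h)) C"
            using circle_lifting[OF C \<tau>[of 0 b d]] bd by auto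
          have v: "lab h \<in> ?T"
            using labelling_value[OF lab lift_upd[OF \<tau>[of 0 b d] h(1)] Ee] bd by simp
          have "(\<tau> 0 b d)(e := h) = \<tau> (lab h) b d"
            using mk(3)[OF Ee h(1)] ij by (auto simp: \<tau>_def fun_eq_iff)
          then show "\<exists>a\<in>?T. B a b d"
            using h(2) v unfolding B_def by metis
        next
          fix a b b' d assume *: "a \<in> ?T" "b \<in> ?T" "b' \<in> ?T" "d \<in> ?T" "B a b d" "B a b' d"
          have "\<tau> a b d i = \<tau> a b' d i"
            by (rule bal_unique[OF C(1) ij(1) \<tau>[OF *(1,2,4)] \<tau>[OF *(1,3,4)]])
              (use * in \<open>auto simp: B_def \<tau>_def\<close>)
          then show "b = b'"
            using lab\<tau>(2)[OF *(1,2,4)] lab\<tau>(2)[OF *(1,3,4)] by metis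
        next
          fix a b d d' assume *: "a \<in> ?T" "b \<in> ?T" "d \<in> ?T" "d' \<in> ?T" "B a b d" "B a b d'"
          have "\<tau> a b d j = \<tau> a b d' j"
            by (rule bal_unique[OF C(1) ij(2) \<tau>[OF *(1,2,3)] \<tau>[OF *(1,2,4)]])
              (use * in \<open>auto simp: B_def \<tau>_def\<close>)
          then show "d = d'"
            using lab\<tau>(3)[OF *(1,2,3)] lab\<tau>(3)[OF *(1,2,4)] by metis
        next
          fix a b d assume *: "a \<in> ?T" "b \<in> ?T" "d \<in> ?T" "b = 0 \<or> d = 0"
          \<comment> \<open>Label 0 at \<open>i\<close> or \<open>j\<close> means that the lift
            equals \<open>s\<close> there, so the support shrinks.\<close>
          have "supp (\<tau> a b d) \<subseteq> supp \<sigma>"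
            using i j(1) by (auto simp: supp_def \<tau>_def)
          moreover have "i \<notin> supp (\<tau> a b d) \<or> j \<notin> supp (\<tau> a b d)"
            using *(4) mk0 ij by (auto simp: supp_def \<tau>_def)
          ultimately have "supp (\<tau> a b d) \<subset> supp \<sigma>"
            using i j(1) by blast
          moreover have "finite (supp \<sigma>)"
            using fin by (simp add: supp_def)
          ultimately have "card (supp (\<tau> a b d)) < card (supp \<sigma>)"
            by (simp add: psubset_card_mono)
          from less.hyps[OF this c \<tau>[OF *(1-3)]]
          show "B a b d \<longleftrightarrow> 3 dvd r + c e * a + c i * b + c j * d"
            unfolding B_def sum[OF *(1-3)] .
        qed
        have v: "lab (\<sigma> e) \<in> ?T" "lab (\<sigma> i) \<in> ?T" "lab (\<sigma> j) \<in> ?T"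
          using labelling_value[OF lab \<sigma>] Ee Ei Ej by blast+
        have "\<tau> (lab (\<sigma> e)) (lab (\<sigma> i)) (lab (\<sigma> j)) = \<sigma>"
          using mk(3) liftD[OF \<sigma>] Ee Ei Ej by (auto simp: \<tau>_def fun_eq_iff)
        then show ?thesis
          using cube[OF v] sum[OF v] by (simp add: B_def)
      qed
    qed
  qed
qed

lemma ends_pair:
  assumes "g \<in> edges \<Delta>" "x \<in> ends \<Delta> g" "x' \<in> ends \<Delta> g" "x \<noteq> x'"
  shows "ends \<Delta> g = {x, x'}" "x' \<in> nodes \<Delta>"
proof -
  have "ends \<Delta> g \<subseteq> nodes \<Delta> \<and> (card (ends \<Delta> g) = 1 \<or> card (ends \<Delta> g) = 2)"
    using expansion assms(1) by (auto simp: biased_expansion_def is_graph_def)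
  then show "ends \<Delta> g = {x, x'}" "x' \<in> nodes \<Delta>"
    using assms(2-4) by (auto simp: card_1_singleton_iff card_2_iff)
qed

text \<open>
  If consecutive edges of the path disagree at a node, no path of \<open>A\<close> bypasses that node; negating
  the labels of all edges of \<open>A\<close> on its far side then restores agreement and keeps all circles of
  \<open>A\<close> good.
\<close>

lemma agreeing_labelling:
  assumes lab: "labelling lab" and A: "A \<subseteq> edges \<Delta>" "e \<notin> A"
    and good: "\<And>C. is_circle \<Delta> C \<Longrightarrow> C \<subseteq> A \<Longrightarrow> good lab C"
    and c: "circle_walk \<Delta> vs (es @ [e])" "set es \<subseteq> A"
  obtains lab' where "labelling lab'" "\<And>C. is_circle \<Delta> C \<Longrightarrow> C \<subseteq> A \<Longrightarrow> good lab' C"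
    "\<And>f. f \<in> set es \<Longrightarrow> agree lab' (insert e (set es)) e f"
proof -
  let ?C = "insert e (set es)"
  have C: "is_circle \<Delta> ?C"
    using c(1) unfolding is_circle_def by (intro exI[of _ vs] exI[of _ "es @ [e]"]) auto
  have p: "is_path \<Delta> vs es" and e_notin: "e \<notin> set es"
    using c(1) by (auto simp: circle_walk_snoc)
  have len: "length vs = Suc (length es)" and dv: "distinct vs" and vs_nodes: "set vs \<subseteq> nodes \<Delta>"
    using p by (auto simp: is_path_def)
  have ends_es: "ends \<Delta> (es ! i) = {vs ! i, vs ! Suc i}" if "i < length es" for i
    using p that by (simp add: is_path_def)
  \<comment> \<open>Agreement with \<open>e\<close> is established along the path edge by edge,
    without ever changing a label of \<open>e\<close>.\<close>
  have "\<exists>lab'. labelling lab' \<and> (\<forall>C. is_circle \<Delta> C \<and> C \<subseteq> A \<longrightarrow> good lab' C) \<and>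
    (\<forall>i<k. agree lab' ?C e (es ! i))" if "k \<le> length es" for k
    using that
  proof (induction k)
    case 0
    then show ?case
      using lab good by blast
  next
    case (Suc k)
    then have k: "k < length es"
      by simp
    from Suc obtain lab' where lab': "labelling lab'" and good': "\<And>C. is_circle \<Delta> C \<Longrightarrow> C \<subseteq> A \<Longrightarrow> good lab' C"
      and ag: "\<And>i. i < k \<Longrightarrow> agree lab' ?C e (es ! i)"
      by auto
    show ?case
    proof (cases "agree lab' ?C e (es ! k)")
      case True
      then show ?thesis
        using lab' good' ag less_Suc_eq by metis
    next
      case disagree: False
      define y where "y = vs ! k"
      \<comment> \<open>\<open>K\<close> collects the nodes that \<open>A\<close> connects to the
        far side of \<open>y\<close> without passing through \<open>y\<close>, and \<open>F\<close>
        the edges of \<open>A\<close> on that side.\<close>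
      define K where "K = {x. \<exists>us ds. is_path \<Delta> us ds \<and> set ds \<subseteq> A \<and> y \<notin> set us \<and> hd us = vs ! Suc k \<and> last us = x}"
      define F where "F = {g \<in> A. \<exists>x\<in>ends \<Delta> g. x \<noteq> y \<and> x \<in> K}"
      have y: "vs ! i = y \<longleftrightarrow> i = k" if "i \<le> length es" for i
        using dv len that k by (auto simp: y_def nth_eq_iff_index_eq)
      have "vs ! Suc k \<in> K"
      proof -
        have "is_path \<Delta> [vs ! Suc k] []"
          using vs_nodes len k by auto
        moreover have "y \<notin> set [vs ! Suc k]"
          using y[of "Suc k"] k by auto
        ultimately have "is_path \<Delta> [vs ! Suc k] [] \<and> set [] \<subseteq> A \<and> y \<notin> set [vs ! Suc k] \<and>
            hd [vs ! Suc k] = vs ! Suc k \<and> last [vs ! Suc k] = vs ! Suc k"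
          by simp
        then show ?thesis
          unfolding K_def by blast
      qed
      then have kF: "es ! k \<in> F"
        unfolding F_def using ends_es[OF k] y[of "Suc k"] c(2) k by auto
      \<comment> \<open>Reaching an earlier node would bypass \<open>y\<close>;
        \<open>agree_transfer\<close> would then carry agreement from the preceding edge to the
        present one. For \<open>k = 0\<close> the claim is void, and the labels are simply
        negated.\<close>
      have noK: "vs ! a \<notin> K" if a: "a < k" for a
      proof
        assume "vs ! a \<in> K"
        then obtain us ds where us: "is_path \<Delta> us ds" "set ds \<subseteq> A" "vs ! k \<notin> set us"
          "hd us = vs ! Suc k" "last us = vs ! a"
          by (auto simp: K_def y_def)
        obtain vs1 es1 vs2 es2 vs3 es3 where t: "theta_paths \<Delta> vs1 es1 vs2 es2 vs3 es3"
          and s: "set es1 \<union> set es2 = ?C" "e \<in> set es2" "es ! k \<in> set es1" "es ! (k - 1) \<in> set es1"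
            "set es1 \<subseteq> set es" "set es3 \<subseteq> A"
          using bridge_theta[OF c(1) k a us A(2)] by blast
        have "is_circle \<Delta> (set es1 \<union> set es3)"
          using t by (auto simp: theta_paths_def intro: internally_disjoint_is_circle)
        then have "good lab' (set es1 \<union> set es3)"
          using good' s(5,6) c(2) by blast
        moreover have "agree lab' (set es1 \<union> set es2) e (es ! (k - 1))"
          using ag[of "k - 1"] a unfolding s(1) by simp
        ultimately have "agree lab' ?C e (es ! k)"
          using agree_transfer[OF lab' t _ s(4,3,2)] unfolding s(1) by blast
        then show False
          using disagree by blast
      qed
      have iF: "es ! i \<notin> F" if i: "i < k" for i
      proof
        assume "es ! i \<in> F"
        then obtain x where x: "x = vs ! i \<or> x = vs ! Suc i" "x \<noteq> y" "x \<in> K"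
          using ends_es[of i] i k by (auto simp: F_def)
        then have "Suc i \<noteq> k \<or> x = vs ! i"
          by (auto simp: y_def)
        then show False
          using x noK[of i] noK[of "Suc i"] i by (metis Suc_lessI)
      qed
      have "good (flip F lab') D" if D: "is_circle \<Delta> D" "D \<subseteq> A" for D
      proof (rule good_flip[OF good'[OF D] is_circle_edges[OF D(1)]])
        obtain ws ds where w: "circle_walk \<Delta> ws ds" "D = set ds"
          using D(1) by (auto simp: is_circle_def)
        have "(\<forall>g\<in>set ds. g \<in> F) \<or> (\<forall>g\<in>set ds. g \<notin> F)"
        proof (rule circle_all_or_none[OF w(1)])
          fix g g' x assume g: "g \<in> set ds" "g' \<in> set ds" "x \<in> ends \<Delta> g" "x \<in> ends \<Delta> g'" "x \<noteq> y" "g \<in> F"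
          have gA: "g \<in> A" "g' \<in> A" "g \<in> edges \<Delta>"
            using g(1,2) D(2) w(2) A(1) by auto
          obtain x0 where x0: "x0 \<in> ends \<Delta> g" "x0 \<noteq> y" "x0 \<in> K"
            using g(6) by (auto simp: F_def)
          \<comment> \<open>A path to the other end of \<open>g\<close> extends along
            \<open>g\<close> to \<open>x\<close>, still avoiding \<open>y\<close>; so membership in
            \<open>F\<close> spreads across every node but \<open>y\<close>.\<close>
          have "x \<in> K"
          proof (cases "x0 = x")
            case False
            obtain us ds where us: "is_path \<Delta> us ds" "set ds \<subseteq> A" "y \<notin> set us" "hd us = vs ! Suc k"
              "last us = x0"
              using x0(3) by (auto simp: K_def)
            have "ends \<Delta> g = {last us, x}" "x \<in> nodes \<Delta>"
              using ends_pair[OF gA(3) x0(1) g(3) False] us(5) by auto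
            from is_path_extend[OF us(1) gA(3) this] obtain us' ds' where
              "is_path \<Delta> us' ds'" "hd us' = hd us" "last us' = x" "set us' \<subseteq> insert x (set us)"
              "set ds' \<subseteq> insert g (set ds)"
              by blast
            moreover have "y \<notin> set us'" "set ds' \<subseteq> A"
              using calculation(4,5) us(2,3) g(5) gA(1) by auto
            ultimately show ?thesis
              unfolding K_def using us(4) by auto
          qed (use x0 in simp)
          then show "g' \<in> F"
            unfolding F_def using gA(2) g(4,5) by auto
        qed
        then show "D \<subseteq> F \<or> D \<inter> F = {}"
          using w(2) by auto
      qed
      moreover have "agree (flip F lab') ?C e (es ! i)" if "i < Suc k" for i
      proof (cases "i = k")
        case True
        have "e \<notin> F" "es ! k \<in> ?C" "e \<noteq> es ! k"
          using A(2) k e_notin by (auto simp: F_def)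
        then show ?thesis
          using agree_or_flip[OF lab' C _ _ _ _ kF] disagree True by auto
      next
        case False
        then have i: "i < k" "i < length es"
          using that k by auto
        have "e \<notin> F" "es ! i \<in> ?C" "e \<noteq> es ! i"
          using A(2) i(2) e_notin by (auto simp: F_def)
        then show ?thesis
          using agree_flip_outside[OF lab' C _ _ _ _ iF[OF i(1)] ag[OF i(1)]] by auto
      qed
      ultimately show ?thesis
        using labelling_flip[OF lab'] by blast
    qed
  qed
  from this[OF order_refl] show ?thesis
    using that by (metis in_set_conv_nth)
qed

text \<open>Unlike for the balanced lift, a new edge may force changes over the old ones: their
  labels are adapted to those of \<open>e\<close>, on a single circle \<open>C0\<close>.\<close>

lemma ex_good_labelling:
  assumes "finite (edges \<Delta>)" "labelling lab0"
  obtains lab where "labelling lab" "\<And>C. is_circle \<Delta> C \<Longrightarrow> good lab C"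
proof -
  have "\<exists>lab. labelling lab \<and> (\<forall>C. is_circle \<Delta> C \<and> C \<subseteq> A \<longrightarrow> good lab C)" if "A \<subseteq> edges \<Delta>" for A
    using finite_subset[OF that assms(1)] that
  proof (induction A rule: finite_induct)
    case empty
    then show ?case
      using assms(2) is_circle_nonempty by blast
  next
    case (insert e A)
    then obtain lab where lab: "labelling lab" and good: "\<And>C. is_circle \<Delta> C \<Longrightarrow> C \<subseteq> A \<Longrightarrow> good lab C"
      by auto
    show ?case
    proof (cases "\<exists>C0. is_circle \<Delta> C0 \<and> e \<in> C0 \<and> C0 \<subseteq> insert e A")
      case False
      then have "good lab C" if "is_circle \<Delta> C" "C \<subseteq> insert e A" for C
        using good[OF that(1)] that by blast
      then show ?thesis
        using lab by blast
    next
      case True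
      then obtain C0 where C0: "is_circle \<Delta> C0" "e \<in> C0" "C0 \<subseteq> insert e A"
        by blast
      obtain vs es where w: "circle_walk \<Delta> vs (es @ [e])" "C0 = insert e (set es)"
        using is_circle_through[OF C0(1,2)] by blast
      have es: "set es \<subseteq> A"
        using w C0(3) by (auto simp: circle_walk_snoc)
      have "A \<subseteq> edges \<Delta>"
        using insert.prems by simp
      from agreeing_labelling[OF lab this insert.hyps(2) good w(1) es]
      obtain lab' where lab': "labelling lab'" and good': "\<And>C. is_circle \<Delta> C \<Longrightarrow> C \<subseteq> A \<Longrightarrow> good lab' C"
        and ag: "\<And>f. f \<in> set es \<Longrightarrow> agree lab' C0 e f"
        unfolding w(2) by metis
      have "good lab' C0"
        by (rule agree_imp_good[OF lab' C0(1,2)]) (use ag w(2) in auto)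
      then have "good lab' C" if "is_circle \<Delta> C" "C \<subseteq> insert e A" for C
        using linear_class_extend[OF linear_class_good[OF lab'] _ C0 _ that] good' by simp
      then show ?thesis
        using lab' by blast
    qed
  qed
  from this[OF order_refl] show ?thesis
    using that is_circle_edges by blast
qed

lemma ex_labelling:
  assumes "\<And>e. e \<in> edges \<Delta> \<Longrightarrow> finite (fiber \<Omega> p e) \<and> card (fiber \<Omega> p e) = 3"
  obtains lab where "labelling lab"
proof -
  have "\<exists>h. bij_betw h (fiber \<Omega> p e - {s e}) {-1, 1::int}" if e: "e \<in> edges \<Delta>" for e
  proof (rule finite_same_card_bij)
    show "card (fiber \<Omega> p e - {s e}) = card {-1, 1::int}"
      using assms[OF e] liftD[OF lift_s e] by simp
  qed (use assms[OF e] in auto)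
  then obtain h where h: "\<And>e. e \<in> edges \<Delta> \<Longrightarrow> bij_betw (h e) (fiber \<Omega> p e - {s e}) {-1, 1::int}"
    by metis
  define lab where "lab f = (if f = s (p f) then 0 else h (p f) f)" for f
  have "labelling lab"
    unfolding labelling_def
  proof (intro ballI conjI)
    fix e assume e: "e \<in> edges \<Delta>"
    have pe: "p f = e" if "f \<in> fiber \<Omega> p e" for f
      using that by (simp add: fiber_def)
    show s0: "lab (s e) = 0"
      using pe[OF liftD[OF lift_s e]] by (simp add: lab_def)
    have "bij_betw lab (fiber \<Omega> p e - {s e}) {-1, 1}"
      using h[OF e] by (rule bij_betw_cong[THEN iffD1, rotated]) (use pe in \<open>auto simp: lab_def\<close>)
    moreover have "bij_betw lab {s e} {0}"
      using s0 by (simp add: bij_betw_def)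
    ultimately have "bij_betw lab ((fiber \<Omega> p e - {s e}) \<union> {s e}) ({-1, 1} \<union> {0})"
      by (rule bij_betw_combine) simp
    moreover have "(fiber \<Omega> p e - {s e}) \<union> {s e} = fiber \<Omega> p e" "{-1, 1} \<union> {0} = {-1, 0, 1::int}"
      using liftD[OF lift_s e] by auto
    ultimately show "bij_betw lab (fiber \<Omega> p e) {-1, 0, 1}"
      by simp
  qed
  then show ?thesis
    by (rule that)
qed

section \<open>The cases of fold three and fold two\<close>

lemma ternary_isomorphic:
  assumes "finite (edges \<Delta>)"
    and card: "\<And>e. e \<in> edges \<Delta> \<Longrightarrow> finite (fiber \<Omega> p e) \<and> card (fiber \<Omega> p e) = 3"
  shows "expansion_isomorphic \<Omega> p (group_expansion (integer_mod_group 3) \<Delta> tail) snd"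
proof -
  obtain lab0 where lab0: "labelling lab0"
    using ex_labelling[OF card] by blast
  from ex_good_labelling[OF assms(1) this] obtain lab where
    lab: "labelling lab" and good: "\<And>C. is_circle \<Delta> C \<Longrightarrow> good lab C"
    by blast
  let ?G = "integer_mod_group 3" and ?h = "\<lambda>a::int. a mod 3"
  show ?thesis
  proof (rule isomorphic_group_expansion[where lab = "\<lambda>f. ?h (lab f)", OF _ orient])
    fix e assume "e \<in> edges \<Delta>"
    then have "bij_betw lab (fiber \<Omega> p e) {-1, 0, 1}"
      using lab by (simp add: labelling_def)
    \<comment> \<open>Reduction modulo 3 turns the label -1 into the residue 2.\<close>
    moreover have "bij_betw ?h {-1, 0, 1} (carrier ?G)"
      by (auto simp: bij_betw_def inj_on_def carrier_integer_mod_group)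
    ultimately show "bij_betw (\<lambda>f. ?h (lab f)) (fiber \<Omega> p e) (carrier ?G)"
      using bij_betw_trans by (fastforce simp: comp_def)
  next
    fix \<sigma> vs es assume \<sigma>: "lift \<sigma>" and w: "circle_walk \<Delta> vs es"
    obtain c where c: "circle_sign (set es) c" "\<And>x. wsum tail x vs es = (\<Sum>e\<in>set es. c e * x e)"
      using circle_sign_ex[OF w] by blast
    have "is_circle \<Delta> (set es)"
      using w by (auto simp: is_circle_def)
    then have "bal \<sigma> (set es) \<longleftrightarrow> ?h (wsum tail (\<lambda>e. lab (\<sigma> e)) vs es) = 0"
      using good c \<sigma> by (simp add: good_def dvd_eq_mod_eq_0)
    also have "?h (wsum tail (\<lambda>e. lab (\<sigma> e)) vs es) =
        gain_product ?G tail vs (map (\<lambda>e. (?h (lab (\<sigma> e)), e)) es)"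
      by (rule gain_product_hom[symmetric])
        (simp_all add: mod_simps carrier_integer_mod_group)
    finally show "bal \<sigma> (set es) \<longleftrightarrow>
        gain_product ?G tail vs (map (\<lambda>e. (?h (lab (\<sigma> e)), e)) es) = \<one>\<^bsub>?G\<^esub>"
      by simp
  qed simp
qed

text \<open>In a fiber of two edges exactly one choice balances the circle, so returning one
  deviating edge to \<open>s\<close> switches balance and lowers the count by one.\<close>

lemma binary_bal:
  assumes card: "\<And>e. e \<in> edges \<Delta> \<Longrightarrow> card (fiber \<Omega> p e) = 2"
    and C: "is_circle \<Delta> C" and \<sigma>: "lift \<sigma>"
  shows "bal \<sigma> C \<longleftrightarrow> even (card {g \<in> C. \<sigma> g \<noteq> s g})"
  using \<sigma>
proof (induction "card {g \<in> C. \<sigma> g \<noteq> s g}" arbitrary: \<sigma>)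
  case 0
  then have "{g \<in> C. \<sigma> g \<noteq> s g} = {}"
    using is_circle_finite[OF C] by simp
  then have "bal \<sigma> C \<longleftrightarrow> bal s C"
    by (intro bal_cong) auto
  then show ?case
    using bal_s[OF C] 0 by simp
next
  case (Suc n)
  then have "{g \<in> C. \<sigma> g \<noteq> s g} \<noteq> {}"
    by (metis card.empty nat.distinct(1))
  then obtain g where g: "g \<in> C" "\<sigma> g \<noteq> s g"
    by blast
  then have E: "g \<in> edges \<Delta>"
    using is_circle_edges[OF C] by auto
  let ?\<tau> = "\<sigma>(g := s g)"
  have \<tau>: "lift ?\<tau>"
    using lift_upd[OF Suc.prems liftD[OF lift_s E]] .
  have "{g' \<in> C. ?\<tau> g' \<noteq> s g'} = {g' \<in> C. \<sigma> g' \<noteq> s g'} - {g}"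
    by auto
  then have n: "n = card {g' \<in> C. ?\<tau> g' \<noteq> s g'}"
    using Suc.hyps(2) g is_circle_finite[OF C] by simp
  have f: "fiber \<Omega> p g = {s g, \<sigma> g}"
    using card[OF E] g(2) liftD[OF lift_s E] liftD[OF Suc.prems E]
    by (auto simp: card_2_iff)
  obtain f where f': "f \<in> fiber \<Omega> p g" "bal (\<sigma>(g := f)) C"
    and uni: "\<And>f'. f' \<in> fiber \<Omega> p g \<Longrightarrow> bal (\<sigma>(g := f')) C \<Longrightarrow> f' = f"
    using circle_lifting[OF C g(1) Suc.prems] by blast
  have "f = s g \<or> f = \<sigma> g"
    using f f'(1) by simp
  then have "bal \<sigma> C \<longleftrightarrow> \<not> bal ?\<tau> C"
  proof
    assume "f = s g"
    moreover have "\<not> bal \<sigma> C"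
      using uni[of "\<sigma> g"] f g(2) \<open>f = s g\<close> by (metis fun_upd_triv insertCI)
    ultimately show ?thesis
      using f'(2) by metis
  next
    assume "f = \<sigma> g"
    moreover have "\<not> bal ?\<tau> C"
      using uni[of "s g"] f g(2) \<open>f = \<sigma> g\<close> by (metis insertCI)
    ultimately show ?thesis
      using f'(2) by (metis fun_upd_triv)
  qed
  also have "\<dots> \<longleftrightarrow> even (Suc n)"
    using Suc.hyps(1)[OF n \<tau>] n by simp
  finally show ?case
    using Suc.hyps(2) by simp
qed

lemma binary_isomorphic:
  assumes card: "\<And>e. e \<in> edges \<Delta> \<Longrightarrow> card (fiber \<Omega> p e) = 2"
  shows "expansion_isomorphic \<Omega> p (group_expansion sign_img \<Delta> tail) snd"
proof -
  \<comment> \<open>This is the homomorphism from the integers onto the group of signs; the labels 0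
    and 1 stand for 1 and -1.\<close>
  let ?h = "\<lambda>a::int. if even a then 1 else -1 :: int"
  define lab where "lab f = (if f = s (p f) then 0 else 1 :: int)" for f
  have lab_lift: "lab (\<sigma> e) = (if \<sigma> e = s e then 0 else 1)" if "lift \<sigma>" "e \<in> edges \<Delta>" for \<sigma> e
    using lift_proj[OF that] by (simp add: lab_def)
  show ?thesis
  proof (rule isomorphic_group_expansion[where lab = "\<lambda>f. ?h (lab f)", OF sign_img_is_group orient])
    fix e assume e: "e \<in> edges \<Delta>"
    have "s e \<in> fiber \<Omega> p e"
      using liftD[OF lift_s e] .
    with card[OF e] obtain f where f: "fiber \<Omega> p e = {s e, f}" "f \<noteq> s e"
      by (auto simp: card_2_iff doubleton_eq_iff)
    then have "p f = e" "p (s e) = e"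
      by (auto simp: fiber_def set_eq_iff)
    then show "bij_betw (\<lambda>f. ?h (lab f)) (fiber \<Omega> p e) (carrier sign_img)"
      using f by (auto simp: bij_betw_def lab_def sign_img_def)
  next
    fix \<sigma> vs es assume \<sigma>: "lift \<sigma>" and w: "circle_walk \<Delta> vs es"
    have C: "is_circle \<Delta> (set es)"
      using w by (auto simp: is_circle_def)
    obtain c where c: "circle_sign (set es) c" "\<And>x. wsum tail x vs es = (\<Sum>e\<in>set es. c e * x e)"
      using circle_sign_ex[OF w] by blast
    \<comment> \<open>The coefficients are odd, so the signed sum has the parity of the number of
      edges off \<open>s\<close>.\<close>
    have "even ((\<Sum>e\<in>set es. c e * lab (\<sigma> e)) - (\<Sum>e\<in>set es. lab (\<sigma> e)))"
    proof -
      have "even (c e * lab (\<sigma> e) - lab (\<sigma> e))" for e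
        using circle_sign_values[OF c(1), of e] by auto
      then show ?thesis
        unfolding sum_subtractf[symmetric] by (intro dvd_sum) auto
    qed
    moreover have "(\<Sum>e\<in>set es. lab (\<sigma> e)) = int (card {g \<in> set es. \<sigma> g \<noteq> s g})"
    proof -
      have "(\<Sum>e\<in>set es. lab (\<sigma> e)) = (\<Sum>e\<in>set es. if \<sigma> e \<noteq> s e then 1 else 0)"
      proof (rule sum.cong)
        fix e assume "e \<in> set es"
        then have "e \<in> edges \<Delta>"
          using is_circle_edges[OF C] by auto
        then show "lab (\<sigma> e) = (if \<sigma> e \<noteq> s e then 1 else 0)"
          using lab_lift[OF \<sigma>, of e] by simp
      qed simp
      then show ?thesis
        by (simp add: sum.If_cases Int_def)
    qed
    ultimately have "even (wsum tail (\<lambda>e. lab (\<sigma> e)) vs es) \<longleftrightarrow> bal \<sigma> (set es)"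
      using binary_bal[OF card C \<sigma>] c(2) by simp
    then have "bal \<sigma> (set es) \<longleftrightarrow> ?h (wsum tail (\<lambda>e. lab (\<sigma> e)) vs es) = 1"
      by simp
    also have "?h (wsum tail (\<lambda>e. lab (\<sigma> e)) vs es) =
        gain_product sign_img tail vs (map (\<lambda>e. (?h (lab (\<sigma> e)), e)) es)"
    proof (rule gain_product_hom[symmetric])
      fix a :: int
      \<comment> \<open>Every sign is its own inverse, in accordance with \<open>a\<close> and
        \<open>- a\<close> having the same parity.\<close>
      have "inv\<^bsub>sign_img\<^esub> ?h a = ?h a"
        by (rule group.inv_equality[OF sign_img_is_group]) (auto simp: sign_img_def)
      then show "?h (- a) = inv\<^bsub>sign_img\<^esub> ?h a"
        by simp
    qed (auto simp: sign_img_def)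
    finally show "bal \<sigma> (set es) \<longleftrightarrow>
        gain_product sign_img tail vs (map (\<lambda>e. (?h (lab (\<sigma> e)), e)) es) = \<one>\<^bsub>sign_img\<^esub>"
      by (simp add: sign_img_def)
  qed
qed

end

theorem theorem7p4:
  fixes \<Delta> :: "('v, 'e) graph"
    and \<Omega> :: "('v, 'f) biased_graph"
    and p :: "'f \<Rightarrow> 'e"
    and \<gamma> :: nat
    and tail :: "'e \<Rightarrow> 'v"
  assumes "finite_graph \<Delta>"
    and "fold_biased_expansion \<gamma> \<Delta> \<Omega> p"
    and "orientation \<Delta> tail"
  shows "(\<gamma> = 2 \<longrightarrow> expansion_isomorphic \<Omega> p (group_expansion sign_img \<Delta> tail) snd) \<and>
         (\<gamma> = 3 \<longrightarrow> expansion_isomorphic \<Omega> p (group_expansion (integer_mod_group 3) \<Delta> tail) snd)"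
proof -
  have fin: "finite (edges \<Delta>)"
    using assms(1) by (simp add: finite_graph_def)
  interpret expansion \<Delta> \<Omega> p
    using assms(2) by unfold_locales (simp add: fold_biased_expansion_def)
  obtain s where "lift s" "\<And>C. is_circle \<Delta> C \<Longrightarrow> bal s C"
    using ex_balanced_lift[OF fin] by blast
  then interpret based_expansion \<Delta> \<Omega> p tail s
    using assms(3) by unfold_locales
  show ?thesis
    using assms(2) binary_isomorphic ternary_isomorphic[OF fin]
    by (auto simp: fold_biased_expansion_def)
qed

end
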